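(* Let $A\in\mathbb{R}^{n\times n}$ be skew-symmetric and $B\in\mathbb{R}^{n\times n}$ symmetric positive definite, and assume that the nonzero eigenvalues $\pm\mathrm{i}\sigma_1,\dots,\pm\mathrm{i}\sigma_\ell$ of $(A,B)$ are simple, with $\sigma_1>\sigma_2>\dots>\sigma_\ell>0$. Let $m<\ell$ and $q_1\in\mathbb{R}^n$ with $\|q_1\|_B=1$ be such that the $m$-step GSSLBD process started with $q_1$ does not break down, and let $p_1=B^{-1}Aq_1/\|B^{-1}Aq_1\|_B$, $F=[p_1,q_1]$, $\mathcal{F}=\mathrm{span}\{p_1,q_1\}$, $$\mathcal{U}_m=\mathcal{K}_m((B^{-1}A)^2,p_1),\qquad \mathcal{V}_m=\mathcal{K}_m((B^{-1}A)^2,q_1).$$ Let $1\le j\le m$ be an integer. For $1\le i\le \ell$ let $X_i=[u_i,v_i]$ and $\mathcal{X}_i=\mathrm{span}\{u_i,v_i\}$ be the eigenspace of $(A,B)$ associated with $\pm\mathrm{i}\sigma_i$. (1) If $X_j^{T}BF$ is nonsingular, then $$\|\tan\angle_B(\mathcal{U}_m\oplus_B\mathcal{V}_m,\mathcal{X}_j)\|_{F}\le\frac{\eta_j}{\chi_{m-j}(\xi_j)}\|\tan\angle_B(\mathcal{F},\mathcal{X}_j)\|_{F},$$ where $\chi_i(\cdot)$ is the degree $i$ Chebyshev polynomial of the first kind and $$\xi_j=1+2\cdot\frac{\sigma_j^2-\sigma_{j+1}^2}{\sigma_{j+1}^2-\sigma_\ell^2},\qquad \eta_j=\begin{cases}1,&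 j=1,\\ \prod_{i=1}^{j-1}\frac{\sigma_i^2-\sigma_\ell^2}{\sigma_i^2-\sigma_j^2},& j>1.\end{cases}$$ (2) If $X_{\ell-j+1}^{T}BF$ is nonsingular, then $$\|\tan\angle_B(\mathcal{U}_m\oplus_B\mathcal{V}_m,\mathcal{X}_{\ell-j+1})\|_{F}\le\frac{\eta_j'}{\chi_{m-j}(\xi_j')}\|\tan\angle_B(\mathcal{F},\mathcal{X}_{\ell-j+1})\|_{F},$$ where $$\xi_j'=1+2\cdot\frac{\sigma_{\ell-j+1}^2-\sigma_{\ell-j}^2}{\sigma_{\ell-j}^2-\sigma_1^2},\qquad \eta_j'=\begin{cases}1,& j=1,\\ \prod_{i=1}^{j-1}\frac{\sigma_{\ell-i+1}^2-\sigma_1^2}{\sigma_{\ell-i+1}^2-\sigma_{\ell-j+1}^2},& j>1.\end{cases}$$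
   Context: Norms: $\|x\|_B=\sqrt{x^{T}Bx}$ for real $x$; $M=B^{1/2}$ is the symmetric positive definite square root of $B$. $\mathcal{K}_m(C,b)=\mathrm{span}\{b,Cb,\dots,C^{m-1}b\}$. Spectral data: the nonzero eigenvalues of $(A,B)$ (i.e. $\lambda$ with $Ax=\lambda Bx$, $x\ne0$) are $\pm\mathrm{i}\sigma_j$, $j=1,\dots,\ell$, where $2\ell=\mathrm{rank}(A)$, with eigenvectors $\frac{1}{\sqrt2}(u_j\pm\mathrm{i}v_j)$, where $u_j,v_j\in\mathbb{R}^n$ satisfy $Av_j=\sigma_jBu_j$, $Au_j=-\sigma_jBv_j$, and $u_1,\dots,u_\ell,v_1,\dots,v_\ell$ are $B$-orthonormal ($x^{T}By=0$ for distinct vectors in the list and $x^{T}Bx=1$). $m$-step GSSLBD process: set $\beta_0=0$, $p_0=0$; for $j=1,\dots,m$: $s_j=B^{-1}Aq_j-\beta_{j-1}p_{j-1}$, $\alpha_j=\|s_j\|_B$, $p_j=s_j/\alpha_j$; $t_j=-B^{-1}Ap_j-\alpha_jq_j$, $\beta_j=\|t_j\|_B$, $q_{j+1}=t_j/\beta_j$. It breaks down if some $\alpha_j=0$ or $\beta_j=0$. When it does not break down, $p_1,\dots,p_m$ and $q_1,\dots,q_m$ are $B$-orthonormal bases of $\mathcal{U}_m$ and $\mathcal{V}_m$, and $p_i^{T}Bq_k=0$ for all $i,k$; $\mathcal{U}_m\oplus_B\mathcal{V}_m$ denotes the ($B$-orthogonal) direct sum of these two $B$-orthogonal subspaces. Angles: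 for subspaces $\mathcal{W},\mathcal{Z}\subseteq\mathbb{R}^n$, the $B$-canonical angles are $\angle_B(\mathcal{W},\mathcal{Z})=\angle(M\mathcal{W},M\mathcal{Z})$, where $\angle(\cdot,\cdot)$ denotes the usual (Euclidean) canonical angles between subspaces. $\|\tan\angle_B(\mathcal{W},\mathcal{Z})\|_F$ is the square root of the sum of squares of the tangents of all $B$-canonical angles between $\mathcal{W}$ and $\mathcal{Z}$; these tangents are the generalized singular values of the pair $(\widetilde W_{\perp_B}^{T}B\widetilde Z,\ \widetilde W^{T}B\widetilde Z)$, where $\widetilde W,\widetilde Z$ are matrices whose columns form $B$-orthonormal bases of $\mathcal{W},\mathcal{Z}$ and $\widetilde W_{\perp_B}$ is such that $[\widetilde W,\widetilde W_{\perp_B}]$ is square and $[\widetilde W,\widetilde W_{\perp_B}]^{T}B[\widetilde W,\widetilde W_{\perp_B}]=I$. Convention: $\chi_0\equiv1$, so when $m=j$ the values of $\xi_j,\xi_j'$ play no role.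
   Formalization: The formal theorem also assumes that q_1 lies in the range of B^{-1}A (automatic if A is nonsingular); for singular A both bounds can fail when q_1 has a component in the kernel of A. *)

theory Defs
  imports
    "HOL-Analysis.Analysis"
    "HOL-Computational_Algebra.Polynomial"
    "HOL-Library.Extended_Real"
begin

section \<open>Matrices and the B-inner product\<close>

definition skew_symmetric :: "real^'n^'n \<Rightarrow> bool" where
  "skew_symmetric A \<longleftrightarrow> transpose A = - A"

definition sym_pos_def :: "real^'n^'n \<Rightarrow> bool" where
  "sym_pos_def B \<longleftrightarrow> transpose B = B \<and> (\<forall>x. x \<noteq> 0 \<longrightarrow> x \<bullet> (B *v x) > 0)"

definition inner_B :: "real^'n^'n \<Rightarrow> real^'n \<Rightarrow> real^'n \<Rightarrow> real" where
  "inner_B B x y = x \<bullet> (B *v y)"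

definition norm_B :: "real^'n^'n \<Rightarrow> real^'n \<Rightarrow> real" where
  "norm_B B x = sqrt (inner_B B x x)"

text \<open>For symmetric positive definite \<open>B\<close> the square root exists and is unique,
  so the choice operator does not matter.\<close>
definition sqrt_matrix :: "real^'n^'n \<Rightarrow> real^'n^'n" where
  "sqrt_matrix B = (SOME M. sym_pos_def M \<and> M ** M = B)"

definition two_cols :: "real^'n \<Rightarrow> real^'n \<Rightarrow> real^2^'n" where
  "two_cols x y = (\<chi> r c. if c = 1 then x $ r else y $ r)"

definition krylov :: "nat \<Rightarrow> real^'n^'n \<Rightarrow> real^'n \<Rightarrow> (real^'n) set" where
  "krylov m C b = span ((\<lambda>k. (((*v) C) ^^ k) b) ` {..<m})"

definition sum_space :: "(real^'n) set \<Rightarrow> (real^'n) set \<Rightarrow> (real^'n) set" where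
  "sum_space U V = {x + y | x y. x \<in> U \<and> y \<in> V}"


section \<open>Eigenvalues of the pencil (A,B)\<close>

definition pencil_eigenvalue :: "real^'n^'n \<Rightarrow> real^'n^'n \<Rightarrow> complex \<Rightarrow> bool" where
  "pencil_eigenvalue A B z \<longleftrightarrow>
     (\<exists>x. x \<noteq> 0 \<and> map_matrix of_real A *v x = z *s (map_matrix of_real B *v x))"

text \<open>The polynomial \<open>det (A - z B)\<close> in the indeterminate \<open>z\<close>.\<close>
definition pencil_charpoly :: "real^'n^'n \<Rightarrow> real^'n^'n \<Rightarrow> complex poly" where
  "pencil_charpoly A B = det (\<chi> r c. [: of_real (A $ r $ c), - of_real (B $ r $ c) :])"

definition simple_pencil_eigenvalue :: "real^'n^'n \<Rightarrow> real^'n^'n \<Rightarrow> complex \<Rightarrow> bool" where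
  "simple_pencil_eigenvalue A B z \<longleftrightarrow>
     pencil_eigenvalue A B z \<and> order z (pencil_charpoly A B) = 1"


section \<open>The GSSLBD process\<close>

text \<open>The state after step \<open>j\<close> is \<open>(\<alpha>\<^sub>j, p\<^sub>j, \<beta>\<^sub>j, q\<^sub>j\<^sub>+\<^sub>1)\<close>; for \<open>j = 0\<close> it is
  \<open>(_, p\<^sub>0, \<beta>\<^sub>0, q\<^sub>1) = (_, 0, 0, q\<^sub>1)\<close> and \<open>\<alpha>\<^sub>0\<close> is never used. After a breakdown the
  recursion continues with meaningless values (\<open>inverse 0 = 0\<close>), but the breakdown itself
  is recorded by the vanishing coefficient.\<close>
primrec gsslbd_state ::
  "real^'n^'n \<Rightarrow> real^'n^'n \<Rightarrow> real^'n \<Rightarrow> nat \<Rightarrow> real \<times> (real^'n) \<times> real \<times> (real^'n)" where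
  "gsslbd_state A B q1 0 = (0, 0, 0, q1)"
| "gsslbd_state A B q1 (Suc j) =
     (case gsslbd_state A B q1 j of (_, p', \<beta>', q) \<Rightarrow>
        let s = (matrix_inv B ** A) *v q - \<beta>' *\<^sub>R p';
            \<alpha> = norm_B B s;
            p = s /\<^sub>R \<alpha>;
            t = - ((matrix_inv B ** A) *v p) - \<alpha> *\<^sub>R q;
            \<beta> = norm_B B t
        in (\<alpha>, p, \<beta>, t /\<^sub>R \<beta>))"

definition gsslbd_alpha :: "real^'n^'n \<Rightarrow> real^'n^'n \<Rightarrow> real^'n \<Rightarrow> nat \<Rightarrow> real" where
  "gsslbd_alpha A B q1 j = fst (gsslbd_state A B q1 j)"

definition gsslbd_beta :: "real^'n^'n \<Rightarrow> real^'n^'n \<Rightarrow> real^'n \<Rightarrow> nat \<Rightarrow> real" where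
  "gsslbd_beta A B q1 j = fst (snd (snd (gsslbd_state A B q1 j)))"

definition gsslbd_breaks_down ::
  "real^'n^'n \<Rightarrow> real^'n^'n \<Rightarrow> real^'n \<Rightarrow> nat \<Rightarrow> bool" where
  "gsslbd_breaks_down A B q1 m \<longleftrightarrow>
     (\<exists>j\<in>{1..m}. gsslbd_alpha A B q1 j = 0 \<or> gsslbd_beta A B q1 j = 0)"


section \<open>Canonical angles\<close>

text \<open>Principal vectors \<open>x 0, \<dots>, x (d - 1)\<close> of \<open>W\<close> and \<open>y 0, \<dots>, y (d - 1)\<close> of \<open>Z\<close>, where
  \<open>d = min (dim W) (dim Z)\<close>: each pair maximises the inner product among the pairs of unit
  vectors that are orthogonal to the preceding ones.\<close>
definition principal_vectors ::
  "'a::euclidean_space set \<Rightarrow> 'a set \<Rightarrow> (nat \<Rightarrow> 'a) \<Rightarrow> (nat \<Rightarrow> 'a) \<Rightarrow> bool" where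
  "principal_vectors W Z x y \<longleftrightarrow>
     (\<forall>k < min (dim W) (dim Z).
        x k \<in> W \<and> y k \<in> Z \<and> norm (x k) = 1 \<and> norm (y k) = 1 \<and>
        (\<forall>i<k. x i \<bullet> x k = 0 \<and> y i \<bullet> y k = 0) \<and>
        (\<forall>w\<in>W. \<forall>z\<in>Z. norm w = 1 \<longrightarrow> norm z = 1 \<longrightarrow>
           (\<forall>i<k. x i \<bullet> w = 0 \<and> y i \<bullet> z = 0) \<longrightarrow> w \<bullet> z \<le> x k \<bullet> y k))"

text \<open>The angles, in increasing order and with repetitions. Principal vectors of subspaces
  exist; they are not unique but the angles are, so the choice operator does not matter.\<close>
definition canonical_angles :: "'a::euclidean_space set \<Rightarrow> 'a set \<Rightarrow> real list" where
  "canonical_angles W Z =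
     (SOME \<theta>. \<exists>x y. principal_vectors W Z x y \<and>
        \<theta> = map (\<lambda>k. arccos (x k \<bullet> y k)) [0 ..< min (dim W) (dim Z)])"

definition canonical_angles_B ::
  "real^'n^'n \<Rightarrow> (real^'n) set \<Rightarrow> (real^'n) set \<Rightarrow> real list" where
  "canonical_angles_B B W Z =
     canonical_angles ((*v) (sqrt_matrix B) ` W) ((*v) (sqrt_matrix B) ` Z)"

text \<open>Extended-real valued, because \<open>tan (pi / 2) = 0\<close> in HOL while the tangent of a right
  angle has to count as infinite here.\<close>
definition tan_angles_frobenius ::
  "real^'n^'n \<Rightarrow> (real^'n) set \<Rightarrow> (real^'n) set \<Rightarrow> ereal" where
  "tan_angles_frobenius B W Z =
     (if pi / 2 \<in> set (canonical_angles_B B W Z) then \<infinity>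
      else ereal (sqrt (\<Sum>\<theta>\<leftarrow>canonical_angles_B B W Z. (tan \<theta>)\<^sup>2)))"


section \<open>The constants of the bounds\<close>

fun chebyshev :: "nat \<Rightarrow> real \<Rightarrow> real" where
  "chebyshev 0 x = 1"
| "chebyshev (Suc 0) x = x"
| "chebyshev (Suc (Suc k)) x = 2 * x * chebyshev (Suc k) x - chebyshev k x"

text \<open>The denominator of \<open>xi\<close> vanishes only for \<open>j = l - 1\<close>, and likewise for \<open>xi'\<close>. With
  \<open>j \<le> m < l\<close> this forces \<open>m = j\<close>, where the bounds involve only \<open>chebyshev 0 = 1\<close>.\<close>
definition xi :: "(nat \<Rightarrow> real) \<Rightarrow> nat \<Rightarrow> nat \<Rightarrow> real" where
  "xi \<sigma> l j = 1 + 2 * (((\<sigma> j)\<^sup>2 - (\<sigma> (j + 1))\<^sup>2) / ((\<sigma> (j + 1))\<^sup>2 - (\<sigma> l)\<^sup>2))"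

definition eta :: "(nat \<Rightarrow> real) \<Rightarrow> nat \<Rightarrow> nat \<Rightarrow> real" where
  "eta \<sigma> l j = (if j = 1 then 1
     else \<Prod>i = 1..j - 1. ((\<sigma> i)\<^sup>2 - (\<sigma> l)\<^sup>2) / ((\<sigma> i)\<^sup>2 - (\<sigma> j)\<^sup>2))"

definition xi' :: "(nat \<Rightarrow> real) \<Rightarrow> nat \<Rightarrow> nat \<Rightarrow> real" where
  "xi' \<sigma> l j = 1 + 2 * (((\<sigma> (l - j + 1))\<^sup>2 - (\<sigma> (l - j))\<^sup>2) / ((\<sigma> (l - j))\<^sup>2 - (\<sigma> 1)\<^sup>2))"

definition eta' :: "(nat \<Rightarrow> real) \<Rightarrow> nat \<Rightarrow> nat \<Rightarrow> real" where
  "eta' \<sigma> l j = (if j = 1 then 1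
     else \<Prod>i = 1..j - 1.
       ((\<sigma> (l - i + 1))\<^sup>2 - (\<sigma> 1)\<^sup>2) / ((\<sigma> (l - i + 1))\<^sup>2 - (\<sigma> (l - j + 1))\<^sup>2))"

(* The theorem requires the starting vector q1 to lie in the range of B^-1 A (no restriction if A
   is nonsingular). This is not in the source, but the bounds fail without it, since they do not
   control a component of q1 in the kernel of A. Example: B = I, n = 7, l = 3, m = 2, j = 1,
   sigma_1^2 = 2, sigma_2^2 = 19/10, sigma_3^2 = 1, q1 = (u_1 + u_3 + z) / sqrt 3 with z a unit
   vector in the kernel. The second bound would read sqrt 2 <= 2/19. *)

end

theory Submission
  imports Defs
begin

text \<open>
  Put \<open>K = B\<^sup>-\<^sup>1 A\<close>. In the \<open>B\<close>-inner product \<open>K\<close> is skew, the planes spanned by \<open>u i\<close>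
  and \<open>v i\<close> are invariant and mutually orthogonal, \<open>K\<^sup>2\<close> is \<open>- (\<sigma> i)\<^sup>2\<close> on the \<open>i\<close>-th plane, and by
  the rank condition these planes fill the range of \<open>K\<close>. So \<open>q1\<close>, which lies in that range, and
  \<open>p1\<close>, a multiple of \<open>K q1\<close>, are the sums of their components in the planes. For
  a polynomial \<open>f\<close> of degree less than \<open>m\<close>, the vectors \<open>f(K\<^sup>2) p1\<close> and \<open>f(K\<^sup>2) q1\<close> lie in
  the two Krylov spaces, and their components are those of \<open>p1\<close> and \<open>q1\<close> multiplied by
  \<open>f(- (\<sigma> i)\<^sup>2)\<close>.

  Fix a target plane with index \<open>k\<close>, and let \<open>f(- (\<sigma> k)\<^sup>2) = 1\<close>. The span of \<open>p1, q1\<close> is the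
  graph of a linear map from the target plane to its orthogonal complement, and the
  tangents of the canonical angles are the singular values of this map; what is needed is that the
  sum of their squares is its squared Frobenius norm (\<open>canonical_angles_tan\<close>). The
  filter \<open>f\<close> scales the parts of this map that lie in the other planes by \<open>f(- (\<sigma> i)\<^sup>2)\<close>, so its
  Frobenius norm is multiplied by at most the number \<open>C\<close> that bounds \<open>\<bar>f(- (\<sigma> i)\<^sup>2)\<bar>\<close> for \<open>i \<noteq> k\<close>
  (\<open>frobenius_tan_filter\<close>). Passing from the filtered plane to the larger sum of
  the Krylov spaces can only decrease the angles (the inequality in \<open>canonical_angles_tan\<close>).
  Together this is \<open>pencil_angle_bound\<close>.

  What remains is a polynomial that is small at the other eigenvalues (\<open>filter_polynomial\<close>). It
  is the product of linear factors that vanish at the \<open>j - 1\<close> eigenvalues on one side of the target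
  and a Chebyshev polynomial of degree \<open>m - j\<close>, shifted and scaled to the interval
  that holds those on the other side. This gives the factors \<open>eta\<close> and \<open>chebyshev (m - j) (xi)\<close>. The
  second bound is the first one for the eigenvalues in reverse order.

  Canonical angles are defined by maximisation, so two facts of linear algebra come
  first: the square root of \<open>B\<close> exists, by the spectral theorem for symmetric matrices,
  and principal vectors exist and are singular vectors of the orthogonal
  projection (\<open>principal_vectors_projection\<close>).
\<close>

section \<open>Orthonormal families\<close>

definition orthonormal_on :: "'i set \<Rightarrow> ('i \<Rightarrow> 'a::real_inner) \<Rightarrow> bool" where
  "orthonormal_on I w \<longleftrightarrow> (\<forall>i\<in>I. \<forall>k\<in>I. w i \<bullet> w k = (if i = k then 1 else 0))"

lemma orthonormal_onD:
  "orthonormal_on I w \<Longrightarrow> i \<in> I \<Longrightarrow> k \<in> I \<Longrightarrow> w i \<bullet> w k = (if i = k then 1 else 0)"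
  unfolding orthonormal_on_def by blast

lemma orthonormal_on_independent:
  assumes "orthonormal_on I w"
  shows "inj_on w I" "independent (w ` I)"
proof -
  show "inj_on w I"
    by (rule inj_onI) (metis assms orthonormal_onD zero_neq_one)
  have "pairwise orthogonal (w ` I)"
    unfolding pairwise_def orthogonal_def using orthonormal_onD[OF assms] by (metis imageE)
  moreover have "0 \<notin> w ` I"
    using orthonormal_onD[OF assms] by (metis imageE inner_zero_left zero_neq_one)
  ultimately show "independent (w ` I)" by (rule pairwise_orthogonal_independent)
qed

lemma inner_sum_orthonormal:
  assumes "orthonormal_on I w" "finite I" "k \<in> I"
  shows "(\<Sum>i\<in>I. c i *\<^sub>R w i) \<bullet> w k = c k"
proof -
  have "(\<Sum>i\<in>I. c i *\<^sub>R w i) \<bullet> w k = (\<Sum>i\<in>I. if i = k then c i else 0)"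
    unfolding inner_sum_left
    by (rule sum.cong) (auto simp: orthonormal_onD[OF assms(1) _ assms(3)])
  also have "\<dots> = c k" using assms by simp
  finally show ?thesis .
qed

lemma orthonormal_expansion_span:
  fixes w :: "'i \<Rightarrow> 'a::real_inner"
  assumes w: "orthonormal_on I w" and I: "finite I" and z: "z \<in> span (w ` I)"
  shows "z = (\<Sum>i\<in>I. (z \<bullet> w i) *\<^sub>R w i)"
proof -
  define r where "r = z - (\<Sum>i\<in>I. (z \<bullet> w i) *\<^sub>R w i)"
  have "r \<bullet> w k = 0" if "k \<in> I" for k
    unfolding r_def inner_diff_left inner_sum_orthonormal[OF w I that] by simp
  then have "orthogonal r a" if "a \<in> span (w ` I)" for a
    by (intro orthogonal_to_span[OF that]) (auto simp: orthogonal_def)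
  moreover have "r \<in> span (w ` I)"
    unfolding r_def by (intro span_diff z span_sum span_scale) (auto intro: span_base)
  ultimately have "r = 0" by (metis orthogonal_self)
  then show ?thesis by (simp add: r_def)
qed

lemma orthonormal_spans:
  fixes w :: "'i \<Rightarrow> 'a::euclidean_space"
  assumes w: "orthonormal_on I w" and Z: "subspace Z"
    and wZ: "w ` I \<subseteq> Z" and dim: "dim Z \<le> card I"
  shows "span (w ` I) = Z"
proof
  show "span (w ` I) \<subseteq> Z" using wZ Z by (rule span_minimal)
  show "Z \<subseteq> span (w ` I)"
    using card_ge_dim_independent[OF wZ orthonormal_on_independent(2)[OF w]] dim
    by (simp add: card_image[OF orthonormal_on_independent(1)[OF w]])
qed

lemma dim_span_orthonormal:
  assumes "orthonormal_on I (w :: 'i \<Rightarrow> 'a::euclidean_space)"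
  shows "dim (span (w ` I)) = card I"
  by (metis assms card_image dim_span_eq_card_independent orthonormal_on_independent)

lemma orthonormal_parseval:
  assumes w: "orthonormal_on I w" and I: "finite I" and z: "z \<in> span (w ` I)"
  shows "z \<bullet> y = (\<Sum>i\<in>I. (z \<bullet> w i) * (y \<bullet> w i))"
proof -
  have "z \<bullet> y = (\<Sum>i\<in>I. (z \<bullet> w i) *\<^sub>R w i) \<bullet> y"
    using orthonormal_expansion_span[OF w I z] by simp
  also have "\<dots> = (\<Sum>i\<in>I. (z \<bullet> w i) * (y \<bullet> w i))"
    unfolding inner_sum_left inner_scaleR_left by (simp add: inner_commute)
  finally show ?thesis .
qed

section \<open>The spectral theorem and positive definite square roots\<close>

text \<open>A maximiser \<open>x\<close> of the Rayleigh quotient on the unit sphere of \<open>S\<close> is an eigenvector.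
  With \<open>c\<close> the maximal value, the quadratic form \<open>c (y \<bullet> y) - y \<bullet> f y\<close> is nonnegative on \<open>S\<close>
  and vanishes at \<open>x\<close>. Moving from \<open>x\<close> by \<open>t\<close> times the residual \<open>r = f x - c x\<close> changes
  the form to first order by \<open>- 2 t (r \<bullet> r)\<close>, which forces \<open>r = 0\<close>.\<close>
lemma self_adjoint_eigenvector:
  fixes f :: "'a::euclidean_space \<Rightarrow> 'a"
  assumes f: "linear f" and sa: "\<And>x y. f x \<bullet> y = x \<bullet> f y"
    and S: "subspace S" and inv: "f ` S \<subseteq> S" and nz: "S \<noteq> {0}"
  shows "\<exists>x\<in>S. norm x = 1 \<and> (\<exists>c. f x = c *\<^sub>R x)"
proof -
  have cont: "continuous_on T f" for T
    using f linear_conv_bounded_linear linear_continuous_on by blast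
  obtain a where a: "a \<in> S" "a \<noteq> 0" using nz S subspace_0 by blast
  have "a /\<^sub>R norm a \<in> S \<inter> sphere 0 1" using a S by (simp add: subspace_scale)
  then have ne: "S \<inter> sphere 0 1 \<noteq> {}" by blast
  have comp: "compact (S \<inter> sphere 0 1)"
    by (intro closed_Int_compact closed_subspace S compact_sphere)
  have "continuous_on (S \<inter> sphere 0 1) (\<lambda>x. x \<bullet> f x)"
    by (intro continuous_intros cont)
  from continuous_attains_sup[OF comp ne this] obtain x
    where x: "x \<in> S" "norm x = 1"
      and max: "\<And>y. y \<in> S \<Longrightarrow> norm y = 1 \<Longrightarrow> y \<bullet> f y \<le> x \<bullet> f x" by auto
  define c where "c = x \<bullet> f x"
  have xx: "x \<bullet> x = 1" using x(2) by (simp add: norm_eq_1)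
  have ray: "y \<bullet> f y \<le> c * (y \<bullet> y)" if y: "y \<in> S" for y
  proof (cases "y = 0")
    case False
    have "(y /\<^sub>R norm y) \<bullet> f (y /\<^sub>R norm y) \<le> c"
      unfolding c_def using y False S by (intro max) (auto simp: subspace_scale)
    then have "(y \<bullet> f y) / (norm y)^2 \<le> c"
      by (simp add: linear_cmul[OF f] power2_eq_square field_simps)
    then show ?thesis using False
      by (simp add: pos_divide_le_eq power2_norm_eq_inner)
  qed (simp add: linear_0[OF f])
  define r where "r = f x - c *\<^sub>R x"
  have r: "r \<in> S" unfolding r_def using x inv S by (auto intro: subspace_diff subspace_scale)
  have xr: "x \<bullet> r = 0" by (simp add: r_def inner_diff_right c_def xx)
  have fxr: "f x \<bullet> r = r \<bullet> r"
    using xr by (simp add: r_def inner_diff_left inner_diff_right inner_commute)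
  have key: "2 * t * (r \<bullet> r) \<le> t^2 * (c * (r \<bullet> r) - r \<bullet> f r)" for t
  proof -
    have "c + 2 * t * (r \<bullet> r) + t^2 * (r \<bullet> f r) = (x + t *\<^sub>R r) \<bullet> f (x + t *\<^sub>R r)"
      using fxr sa[of x r]
      by (simp add: linear_add[OF f] linear_cmul[OF f] inner_add_left inner_add_right c_def
          power2_eq_square algebra_simps inner_commute)
    also have "\<dots> \<le> c * ((x + t *\<^sub>R r) \<bullet> (x + t *\<^sub>R r))"
      by (intro ray subspace_add S x subspace_scale r)
    also have "(x + t *\<^sub>R r) \<bullet> (x + t *\<^sub>R r) = 1 + t^2 * (r \<bullet> r)"
      using xr by (simp add: inner_add_left inner_add_right xx power2_eq_square inner_commute)
    finally show ?thesis by (simp add: algebra_simps)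
  qed
  have "r \<bullet> r \<le> 0"
  proof (rule ccontr)
    assume "\<not> r \<bullet> r \<le> 0"
    then have pos: "r \<bullet> r > 0" by linarith
    define k where "k = c * (r \<bullet> r) - r \<bullet> f r"
    \<comment> \<open>a step so short that the first-order term of \<open>key\<close> exceeds the second-order term\<close>
    define t where "t = (r \<bullet> r) / (\<bar>k\<bar> + 1)"
    have t: "t > 0" using pos by (simp add: t_def)
    have "2 * (r \<bullet> r) \<le> t * k"
      using key[of t] t by (simp add: k_def power2_eq_square)
    also have "\<dots> \<le> t * (\<bar>k\<bar> + 1)" using t by (intro mult_left_mono) auto
    also have "\<dots> = r \<bullet> r" by (simp add: t_def)
    finally show False using pos by simp
  qed
  then have "r \<bullet> r = 0" by (intro antisym) auto
  then have "f x = c *\<^sub>R x" by (simp add: r_def)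
  then show ?thesis using x by blast
qed

text \<open>By induction on the dimension: the orthogonal complement in \<open>S\<close> of an eigenvector is again
  invariant, because \<open>f\<close> is self-adjoint.\<close>
lemma self_adjoint_eigenbasis:
  fixes f :: "'a::euclidean_space \<Rightarrow> 'a"
  assumes f: "linear f" and sa: "\<And>x y. f x \<bullet> y = x \<bullet> f y"
    and S: "subspace S" and inv: "f ` S \<subseteq> S"
  shows "\<exists>E. finite E \<and> orthonormal_on E id \<and> span E = S \<and> (\<forall>e\<in>E. \<exists>c. f e = c *\<^sub>R e)"
  using S inv
proof (induction "dim S" arbitrary: S rule: less_induct)
  case less
  show ?case
  proof (cases "S = {0}")
    case True
    then show ?thesis by (intro exI[of _ "{}"]) (simp add: orthonormal_on_def)
  next
    case False
    obtain x c where x: "x \<in> S" "norm x = 1" "f x = c *\<^sub>R x"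
      using self_adjoint_eigenvector[OF f sa less.prems False] by blast
    have xx: "x \<bullet> x = 1" using x(2) by (simp add: norm_eq_1)
    define S' where "S' = S \<inter> {y. orthogonal x y}"
    have S': "subspace S'"
      unfolding S'_def by (intro subspace_inter less.prems subspace_orthogonal_to_vector)
    have "x \<notin> S'" using xx by (auto simp: S'_def orthogonal_def)
    then have "S' \<subset> S" using x by (auto simp: S'_def)
    then have "dim S' < dim S"
      using S' less.prems(1) by (intro dim_psubset) (simp add: span_eq_iff[THEN iffD2])
    moreover have "f ` S' \<subseteq> S'"
    proof -
      have "x \<bullet> f y = 0" if "x \<bullet> y = 0" for y
        using sa[of x y] x(3) that by simp
      then show ?thesis using less.prems(2) by (auto simp: S'_def orthogonal_def)
    qed
    ultimately obtain E where E: "finite E" "orthonormal_on E id" "span E = S'"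
      "\<forall>e\<in>E. \<exists>c. f e = c *\<^sub>R e" using less.hyps S' by blast
    have ES: "E \<subseteq> S'" using E(3) span_superset by blast
    have "orthonormal_on (insert x E) id"
      using E(2) ES xx \<open>x \<notin> S'\<close>
      by (auto simp: orthonormal_on_def S'_def orthogonal_def inner_commute)
    moreover have "span (insert x E) = S"
    proof
      show "span (insert x E) \<subseteq> S"
        using ES x(1) less.prems(1) by (intro span_minimal) (auto simp: S'_def)
      show "S \<subseteq> span (insert x E)"
      proof
        fix y assume y: "y \<in> S"
        have "y - (x \<bullet> y) *\<^sub>R x \<in> S'"
          using y x less.prems(1) xx
          by (auto simp: S'_def orthogonal_def inner_diff_right intro: subspace_diff subspace_scale)
        then show "y \<in> span (insert x E)"
          unfolding E(3)[symmetric] by (auto simp: span_insert)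
      qed
    qed
    ultimately show ?thesis using E x(3) by (intro exI[of _ "insert x E"]) auto
  qed
qed

lemma symmetric_matrix_inner:
  fixes A :: "real^'n^'n"
  assumes "transpose A = A"
  shows "(A *v x) \<bullet> y = x \<bullet> (A *v y)"
  by (metis assms dot_lmul_matrix vector_transpose_matrix)

text \<open>The square root replaces each eigenvalue \<open>c e\<close> in an orthonormal eigenbasis \<open>E\<close> by its
  positive root.\<close>
lemma sym_pos_def_sqrt_exists:
  fixes B :: "real^'n^'n"
  assumes B: "sym_pos_def B"
  shows "\<exists>M. sym_pos_def M \<and> M ** M = B"
proof -
  have sym: "transpose B = B" and pos: "\<And>x. x \<noteq> 0 \<Longrightarrow> x \<bullet> (B *v x) > 0"
    using B by (auto simp: sym_pos_def_def)
  obtain E where E: "finite E" "orthonormal_on E id" "span E = (UNIV :: (real^'n) set)"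
    and "\<forall>e\<in>E. \<exists>c. B *v e = c *\<^sub>R e"
    using self_adjoint_eigenbasis[of "(*v) B" UNIV] symmetric_matrix_inner[OF sym] by auto
  then obtain c where c: "\<And>e. e \<in> E \<Longrightarrow> B *v e = c e *\<^sub>R e" by metis
  have ee: "e \<bullet> e = 1" if "e \<in> E" for e using orthonormal_onD[OF E(2) that that] by simp
  have cpos: "c e > 0" if "e \<in> E" for e
  proof -
    have "e \<noteq> 0" using ee[OF that] by auto
    then show ?thesis using pos[of e] c[OF that] ee[OF that] by simp
  qed
  define g where "g x = (\<Sum>e\<in>E. (sqrt (c e) * (x \<bullet> e)) *\<^sub>R e)" for x
  have g: "linear g"
    unfolding g_def
    by (rule linearI) (simp_all add: inner_add_left algebra_simps sum.distrib scaleR_sum_right)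
  define M where "M = matrix g"
  have M: "M *v x = g x" for x using g by (simp add: M_def)
  have gy: "y \<bullet> g x = (\<Sum>e\<in>E. sqrt (c e) * (x \<bullet> e) * (y \<bullet> e))" for x y
    by (simp add: g_def inner_sum_right)
  have "adjoint g = g"
    by (rule adjoint_unique) (simp add: gy, simp add: inner_commute[of "g _"] gy mult_ac)
  then have "transpose M = M" using matrix_adjoint[OF g] by (simp add: M_def)
  moreover have "x \<bullet> (M *v x) > 0" if "x \<noteq> 0" for x
  proof -
    have "x \<bullet> g x \<noteq> 0"
    proof
      assume "x \<bullet> g x = 0"
      moreover have "0 \<le> sqrt (c e) * (x \<bullet> e) * (x \<bullet> e)" if "e \<in> E" for e
        using cpos[OF that] by (simp add: mult.assoc)
      ultimately have "\<forall>e\<in>E. sqrt (c e) * (x \<bullet> e) * (x \<bullet> e) = 0"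
        using E(1) by (simp add: gy sum_nonneg_eq_0_iff)
      then have "x \<bullet> e = 0" if "e \<in> E" for e using cpos that by fastforce
      then have "x = 0"
        using orthonormal_expansion_span[OF E(2,1), of x] E(3) by simp
      with that show False by simp
    qed
    moreover have "x \<bullet> g x \<ge> 0"
      unfolding gy using cpos by (intro sum_nonneg) (simp add: mult.assoc less_imp_le)
    ultimately show ?thesis by (simp add: M)
  qed
  moreover have "M ** M = B"
  proof -
    have ge: "g e = sqrt (c e) *\<^sub>R e" if "e \<in> E" for e
    proof -
      have "g e = (\<Sum>e'\<in>E. if e' = e then sqrt (c e) *\<^sub>R e else 0)"
        unfolding g_def
        by (rule sum.cong) (use orthonormal_onD[OF E(2) that] in auto)
      then show ?thesis using E(1) that by simp
    qed
    have "g (g e) = B *v e" if "e \<in> E" for e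
      using ge[OF that] linear_cmul[OF g, of "sqrt (c e)" e] cpos[OF that] c[OF that] by simp
    then have "g (g x) = B *v x" for x
      using linear_eq_on[OF linear_compose[OF g g] matrix_vector_mul_linear[of B], of x E] E(3)
      by simp
    then show ?thesis by (simp add: matrix_eq M flip: matrix_vector_mul_assoc)
  qed
  ultimately show ?thesis by (auto simp: sym_pos_def_def)
qed

lemma sqrt_matrix:
  fixes B :: "real^'n^'n"
  assumes "sym_pos_def B"
  shows "sym_pos_def (sqrt_matrix B)" "sqrt_matrix B ** sqrt_matrix B = B"
  using someI_ex[OF sym_pos_def_sqrt_exists[OF assms]] by (simp_all add: sqrt_matrix_def)

text \<open>The square root is thus an isometry from the \<open>B\<close>-inner product to the Euclidean one. It
  turns all questions about \<open>B\<close>-angles into questions about Euclidean angles.\<close>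
lemma inner_B_eq_inner_sqrt:
  assumes "sym_pos_def B"
  shows "inner_B B x y = (sqrt_matrix B *v x) \<bullet> (sqrt_matrix B *v y)"
proof -
  have "transpose (sqrt_matrix B) = sqrt_matrix B"
    using sqrt_matrix(1)[OF assms] by (simp add: sym_pos_def_def)
  then show ?thesis
    by (simp add: inner_B_def symmetric_matrix_inner matrix_vector_mul_assoc sqrt_matrix(2)[OF assms])
qed

section \<open>Principal vectors\<close>

text \<open>The vectors are chosen one pair after the other. After \<open>N\<close> pairs the admissible unit vectors
  form a compact set, which is nonempty as long as \<open>N\<close> is below both dimensions.\<close>
lemma principal_vectors_exist:
  fixes W Z :: "'a::euclidean_space set"
  assumes W: "subspace W" and Z: "subspace Z"
  shows "\<exists>x y. principal_vectors W Z x y"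
proof -
  define P where "P k x y \<longleftrightarrow>
        x k \<in> W \<and> y k \<in> Z \<and> norm (x k) = 1 \<and> norm (y k) = 1 \<and>
        (\<forall>i<k. x i \<bullet> x k = 0 \<and> y i \<bullet> y k = 0) \<and>
        (\<forall>w\<in>W. \<forall>z\<in>Z. norm w = 1 \<longrightarrow> norm z = 1 \<longrightarrow>
           (\<forall>i<k. x i \<bullet> w = 0 \<and> y i \<bullet> z = 0) \<longrightarrow> w \<bullet> z \<le> x k \<bullet> y k)"
    for k and x y :: "nat \<Rightarrow> 'a"
  have "N \<le> min (dim W) (dim Z) \<Longrightarrow> \<exists>x y. \<forall>k<N. P k x y" for N
  proof (induction N)
    case (Suc N)
    then obtain x y where xy: "\<forall>k<N. P k x y" by auto
    define S where "S w V = V \<inter> {v. \<forall>i<N. w i \<bullet> v = 0}" for w and V :: "'a set"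
    have unit: "\<exists>v\<in>S w V. norm v = 1" if V: "subspace V" and N: "N < dim V" and w: "\<forall>i<N. w i \<in> V"
      for w V
    proof -
      have "dim (w ` {..<N}) < dim V"
        using dim_le_card'[of "w ` {..<N}"] card_image_le[of "{..<N}" w] N by simp
      moreover have "span (w ` {..<N}) \<subseteq> span V"
        using w by (intro span_mono) auto
      ultimately have "span (w ` {..<N}) \<subset> span V" by (metis dim_span less_irrefl psubsetI)
      then obtain v where v: "v \<noteq> 0" "v \<in> span V"
        "\<And>y. y \<in> span (w ` {..<N}) \<Longrightarrow> orthogonal v y"
        using orthogonal_to_subspace_exists_gen by blast
      have "w i \<bullet> v = 0" if "i < N" for i
        using v(3)[of "w i"] that by (simp add: span_base orthogonal_def inner_commute)
      moreover have "v \<in> V" using v(2) V by (metis span_eq_iff)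
      ultimately have "v /\<^sub>R norm v \<in> S w V"
        using V by (auto simp: S_def intro: subspace_scale)
      then show ?thesis using v(1) by (intro bexI[of _ "v /\<^sub>R norm v"]) auto
    qed
    have comp: "compact (S w V \<inter> sphere 0 1)" if "subspace V" for w V
    proof -
      have "closed {v. \<forall>i<N. w i \<bullet> v = 0}"
        by (intro closed_Collect_all closed_Collect_imp closed_Collect_eq continuous_intros) auto
      then show ?thesis unfolding S_def
        using that closed_subspace by (intro closed_Int_compact closed_Int) auto
    qed
    let ?C = "(S x W \<inter> sphere 0 1) \<times> (S y Z \<inter> sphere 0 1)"
    have "\<exists>v\<in>S x W. norm v = 1" "\<exists>v\<in>S y Z. norm v = 1"
      using xy Suc.prems by (auto simp: P_def intro!: unit W Z)
    then have "?C \<noteq> {}" by force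
    moreover have "compact ?C" by (intro compact_Times comp W Z)
    moreover have "continuous_on ?C (\<lambda>(a, b). a \<bullet> b)"
      unfolding case_prod_beta by (intro continuous_intros)
    ultimately obtain p where p: "p \<in> ?C"
      "\<forall>q\<in>?C. (case q of (w, z) \<Rightarrow> w \<bullet> z) \<le> (case p of (w, z) \<Rightarrow> w \<bullet> z)"
      using continuous_attains_sup[of ?C "\<lambda>(w, z). w \<bullet> z"] by blast
    obtain a b where ab: "p = (a, b)" by (cases p)
    have "P k (x(N := a)) (y(N := b))" if "k < Suc N" for k
    proof (cases "k = N")
      case True
      then show ?thesis using p ab by (auto simp: P_def S_def)
    next
      case False
      then have "P k x y" "k < N" using that xy by auto
      then show ?thesis by (simp add: P_def)
    qed
    then show ?case by blast
  qed simp
  from this[OF order.refl] show ?thesis unfolding principal_vectors_def P_def by blast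
qed

lemma principal_vectors_commute:
  assumes "principal_vectors W Z x y" shows "principal_vectors Z W y x"
  unfolding principal_vectors_def
proof (intro allI impI)
  fix k assume "k < min (dim Z) (dim W)"
  then have "k < min (dim W) (dim Z)" by simp
  note pv = assms[unfolded principal_vectors_def, rule_format, OF this]
  show "y k \<in> Z \<and> x k \<in> W \<and> norm (y k) = 1 \<and> norm (x k) = 1 \<and>
         (\<forall>i<k. y i \<bullet> y k = 0 \<and> x i \<bullet> x k = 0) \<and>
         (\<forall>w\<in>Z. \<forall>z\<in>W. norm w = 1 \<longrightarrow> norm z = 1 \<longrightarrow>
           (\<forall>i<k. y i \<bullet> w = 0 \<and> x i \<bullet> z = 0) \<longrightarrow> w \<bullet> z \<le> y k \<bullet> x k)"
  proof (intro conjI ballI impI)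
    fix w z assume wz: "w \<in> Z" "z \<in> W" "norm w = 1" "norm z = 1" "\<forall>i<k. y i \<bullet> w = 0 \<and> x i \<bullet> z = 0"
    then have "z \<bullet> w \<le> x k \<bullet> y k" using pv by blast
    then show "w \<bullet> z \<le> y k \<bullet> x k" by (simp only: inner_commute)
  qed (use pv in blast)+
qed

text \<open>If \<open>g\<close> is the orthogonal projection of \<open>y\<close> onto \<open>S\<close>, then \<open>w \<bullet> y = w \<bullet> g\<close> on \<open>S\<close>, and
  a unit vector \<open>x\<close> of \<open>S\<close> that maximises this can only satisfy \<open>g = (x \<bullet> y) x\<close>.\<close>
lemma maximiser_is_projection:
  fixes y :: "'a::euclidean_space"
  assumes S: "subspace S" and x: "x \<in> S" "norm x = 1"
    and max: "\<And>w. w \<in> S \<Longrightarrow> norm w = 1 \<Longrightarrow> w \<bullet> y \<le> x \<bullet> y"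
    and w: "w \<in> S"
  shows "w \<bullet> y = (x \<bullet> y) * (w \<bullet> x)"
proof -
  obtain g h where g: "g \<in> S" and h: "\<And>w. w \<in> S \<Longrightarrow> orthogonal h w" and y: "y = g + h"
    using orthogonal_subspace_decomp_exists[of S y] S by (metis span_eq_iff)
  have yg: "v \<bullet> y = v \<bullet> g" if "v \<in> S" for v
    using h[OF that] by (simp add: y inner_add_right orthogonal_def inner_commute)
  define c where "c = x \<bullet> y"
  have c0: "c \<ge> 0" using max[of "- x"] x S by (simp add: c_def subspace_neg)
  have "norm g \<le> c"
  proof (cases "g = 0")
    case False
    have "(g /\<^sub>R norm g) \<bullet> y \<le> c"
      unfolding c_def using g False S by (intro max) (auto simp: subspace_scale)
    moreover have "(g /\<^sub>R norm g) \<bullet> y = norm g"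
      using False by (simp add: yg[OF g] power2_norm_eq_inner[symmetric] power2_eq_square)
    ultimately show ?thesis by simp
  qed (simp add: c0)
  then have "g \<bullet> g \<le> c^2"
    using power_mono[of "norm g" c 2] by (simp add: power2_norm_eq_inner)
  moreover have "g \<bullet> x = c" using yg[OF x(1)] by (simp add: c_def inner_commute)
  moreover have "x \<bullet> x = 1" using x(2) by (simp add: norm_eq_1)
  ultimately have "(norm (g - c *\<^sub>R x))\<^sup>2 \<le> 0"
    unfolding power2_norm_eq_inner
    by (simp add: inner_diff_left inner_diff_right inner_commute power2_eq_square)
  then have "g = c *\<^sub>R x" by simp
  then show ?thesis using yg[OF w] by (simp add: c_def)
qed

lemma principal_vectors_unit:
  assumes "principal_vectors W Z x y" "k < min (dim W) (dim Z)"
  shows "x k \<in> W" "y k \<in> Z" "norm (x k) = 1" "norm (y k) = 1"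
  using assms by (auto simp: principal_vectors_def)

lemma principal_vectors_orthonormal:
  assumes "principal_vectors W Z x y"
  shows "orthonormal_on {..<min (dim W) (dim Z)} x" "orthonormal_on {..<min (dim W) (dim Z)} y"
proof -
  have *: "orthonormal_on {..<min (dim W) (dim Z)} x" if "principal_vectors W Z x y"
    for W Z :: "'a set" and x y
    unfolding orthonormal_on_def
  proof (intro ballI)
    fix i k assume ik: "i \<in> {..<min (dim W) (dim Z)}" "k \<in> {..<min (dim W) (dim Z)}"
    have lt: "x i \<bullet> x k = 0" if "i < k" "k < min (dim W) (dim Z)" for i k
      using \<open>principal_vectors W Z x y\<close> that unfolding principal_vectors_def by blast
    have "x i \<bullet> x k = 0" if "i \<noteq> k"
      using that lt[of i k] lt[of k i] ik by (metis inner_commute lessThan_iff linorder_neqE_nat)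
    moreover have "x i \<bullet> x i = 1"
      using principal_vectors_unit(3)[OF that] ik by (simp add: norm_eq_1)
    ultimately show "x i \<bullet> x k = (if i = k then 1 else 0)" by (cases "i = k") auto
  qed
  show "orthonormal_on {..<min (dim W) (dim Z)} x" using *[OF assms] .
  show "orthonormal_on {..<min (dim W) (dim Z)} y"
    using *[OF principal_vectors_commute[OF assms]] by (simp add: min.commute)
qed

text \<open>Principal vectors are singular vectors of the orthogonal projections between the two
  subspaces: the projection of \<open>y k\<close> onto \<open>W\<close> is \<open>(x k \<bullet> y k) x k\<close>, and symmetrically. The
  definition yields this only on the part of \<open>W\<close> orthogonal to the earlier \<open>x i\<close>. On their span it
  holds because \<open>x i \<bullet> y k\<close> is a multiple of \<open>y i \<bullet> y k = 0\<close> by the statement for \<open>i\<close> with the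
  roles of \<open>W\<close> and \<open>Z\<close> exchanged, which is why both halves are proved in one induction.\<close>
lemma principal_vectors_projection:
  fixes W Z :: "'a::euclidean_space set"
  assumes W: "subspace W" and Z: "subspace Z" and xy: "principal_vectors W Z x y"
    and k: "k < min (dim W) (dim Z)"
  shows "(\<forall>w\<in>W. w \<bullet> y k = (x k \<bullet> y k) * (w \<bullet> x k)) \<and> (\<forall>z\<in>Z. x k \<bullet> z = (x k \<bullet> y k) * (y k \<bullet> z))"
  using k
proof (induction k rule: less_induct)
  case (less k)
  have step: "w \<bullet> y k = (x k \<bullet> y k) * (w \<bullet> x k)"
    if W: "subspace W" and xy: "principal_vectors W Z x y" and k: "k < min (dim W) (dim Z)"
      and prev: "\<And>i z. i < k \<Longrightarrow> z \<in> Z \<Longrightarrow> x i \<bullet> z = (x i \<bullet> y i) * (y i \<bullet> z)"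
      and w: "w \<in> W"
    for W Z :: "'a set" and x y w
  proof -
    note pv = xy[unfolded principal_vectors_def, rule_format]
    note on = principal_vectors_orthonormal[OF xy]
    define S where "S = {w\<in>W. \<forall>i<k. x i \<bullet> w = 0}"
    have S: "subspace S"
      using W by (auto simp: S_def subspace_def inner_add_right)
    have ox: "orthonormal_on {..<k} x" and xx: "x i \<bullet> x k = 0" "y i \<bullet> y k = 0" if "i < k" for i
      using on k that by (auto simp: orthonormal_on_def)
    define w' where "w' = w - (\<Sum>i<k. (w \<bullet> x i) *\<^sub>R x i)"
    have wS: "w' \<in> S"
    proof -
      have "(\<Sum>i<k. (w \<bullet> x i) *\<^sub>R x i) \<in> W"
        using principal_vectors_unit(1)[OF xy] k
        by (intro subspace_sum subspace_scale W) auto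
      moreover have "x i \<bullet> w' = 0" if "i < k" for i
        using inner_sum_orthonormal[OF ox[OF that], of i "\<lambda>i. w \<bullet> x i"] that
        by (simp add: w'_def inner_diff_right inner_commute)
      ultimately show ?thesis using w W by (auto simp: S_def w'_def intro: subspace_diff)
    qed
    have "w' \<bullet> y k = (x k \<bullet> y k) * (w' \<bullet> x k)"
    proof (rule maximiser_is_projection[OF S _ _ _ wS])
      show "x k \<in> S" using principal_vectors_unit(1)[OF xy k] xx by (simp add: S_def)
      show "norm (x k) = 1" using principal_vectors_unit(3)[OF xy k] .
      show "v \<bullet> y k \<le> x k \<bullet> y k" if "v \<in> S" "norm v = 1" for v
        using pv[OF k] that principal_vectors_unit[OF xy k] xx by (auto simp: S_def)
    qed
    moreover have "w' \<bullet> y k = w \<bullet> y k"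
    proof -
      have "(\<Sum>i<k. (w \<bullet> x i) *\<^sub>R x i) \<bullet> y k = 0"
        unfolding inner_sum_left using prev principal_vectors_unit(2)[OF xy k] xx
        by (intro sum.neutral) auto
      then show ?thesis by (simp add: w'_def inner_diff_left)
    qed
    moreover have "w' \<bullet> x k = w \<bullet> x k"
    proof -
      have "(\<Sum>i<k. (w \<bullet> x i) *\<^sub>R x i) \<bullet> x k = 0"
        unfolding inner_sum_left using xx by (intro sum.neutral) auto
      then show ?thesis by (simp add: w'_def inner_diff_left)
    qed
    ultimately show ?thesis by simp
  qed
  have "\<forall>w\<in>W. w \<bullet> y k = (x k \<bullet> y k) * (w \<bullet> x k)"
    using step[OF W xy less.prems] less by force
  moreover have "z \<bullet> x k = (y k \<bullet> x k) * (z \<bullet> y k)" if "z \<in> Z" for z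
  proof (rule step[OF Z principal_vectors_commute[OF xy] _ _ that])
    show "k < min (dim Z) (dim W)" using less.prems by simp
    show "y i \<bullet> z = (y i \<bullet> x i) * (x i \<bullet> z)" if "i < k" "z \<in> W" for i z
      using less.IH[of i] less.prems that by (simp add: inner_commute)
  qed
  ultimately show ?case by (simp add: inner_commute)
qed

section \<open>Tangents of canonical angles\<close>

definition frobenius_tan :: "'a::euclidean_space set \<Rightarrow> 'a set \<Rightarrow> ereal" where
  "frobenius_tan W Z = (if pi / 2 \<in> set (canonical_angles W Z) then \<infinity>
      else ereal (sqrt (\<Sum>\<theta>\<leftarrow>canonical_angles W Z. (tan \<theta>)\<^sup>2)))"

lemma tan_angles_frobenius_eq:
  "tan_angles_frobenius B W Z
    = frobenius_tan ((*v) (sqrt_matrix B) ` W) ((*v) (sqrt_matrix B) ` Z)"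
  by (simp add: tan_angles_frobenius_def frobenius_tan_def canonical_angles_B_def)

lemma tan_arccos_sq: "0 < c \<Longrightarrow> c \<le> 1 \<Longrightarrow> (tan (arccos c))\<^sup>2 = 1 / c\<^sup>2 - 1"
  by (simp add: tan_def sin_arccos_abs power_divide abs_le_iff diff_divide_distrib abs_square_le_1)

text \<open>Let \<open>L\<close> be the linear map from \<open>Z\<close> to its orthogonal complement that sends \<open>e i\<close> to
  \<open>t i\<close>, so that \<open>W\<close> contains the graph of \<open>L\<close>. For a principal vector \<open>y\<close> of \<open>Z\<close> with cosine
  \<open>c\<close> and partner \<open>x\<close>, the vector \<open>y + L y\<close> of \<open>W\<close> satisfies
  \<open>1 = (y + L y) \<bullet> y = c ((y + L y) \<bullet> x) \<le> c * norm (y + L y)\<close>, that is, \<open>1 / c\<^sup>2 - 1 \<le> (norm (L y))\<^sup>2\<close>;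
  the left-hand side is the squared tangent. Summing over the orthonormal basis of principal vectors
  gives the squared Frobenius norm of \<open>L\<close>, which may be computed in the basis \<open>e\<close> as well. If
  \<open>W\<close> is the graph itself, then \<open>x\<close> lies on the graph over its projection \<open>c y\<close>, so \<open>x\<close> is a
  multiple of \<open>y + L y\<close> and the Cauchy-Schwarz step is an equality.\<close>
lemma canonical_angles_tan:
  fixes W Z :: "'a::euclidean_space set" and e t :: "nat \<Rightarrow> 'a"
  assumes W: "subspace W" and e: "orthonormal_on {..<d} e" and Z: "Z = span (e ` {..<d})"
    and orth: "\<And>i k. i < d \<Longrightarrow> k < d \<Longrightarrow> t i \<bullet> e k = 0"
    and eW: "\<And>i. i < d \<Longrightarrow> e i + t i \<in> W"
  defines "\<Theta> \<equiv> canonical_angles W Z"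
  shows "pi / 2 \<notin> set \<Theta>"
    and "(\<Sum>\<theta>\<leftarrow>\<Theta>. (tan \<theta>)\<^sup>2) \<le> (\<Sum>i<d. (norm (t i))\<^sup>2)"
    and "W = span ((\<lambda>i. e i + t i) ` {..<d}) \<Longrightarrow> (\<Sum>\<theta>\<leftarrow>\<Theta>. (tan \<theta>)\<^sup>2) = (\<Sum>i<d. (norm (t i))\<^sup>2)"
proof -
  have sZ: "subspace Z" by (simp add: Z)
  have dZ: "dim Z = d" using dim_span_orthonormal[OF e] by (simp add: Z)
  \<comment> \<open>The orthogonal projection onto \<open>Z\<close> maps \<open>W\<close> onto \<open>Z\<close>. So \<open>dim W\<close> is at least \<open>d\<close>, and there are
    \<open>d\<close> angles.\<close>
  define P where "P z = (\<Sum>i<d. (z \<bullet> e i) *\<^sub>R e i)" for z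
  have "linear P"
    unfolding P_def by (rule linearI) (simp_all add: inner_add_left scaleR_sum_right sum.distrib algebra_simps)
  have PT: "P (e i + t i) = e i" if "i < d" for i
    using orthonormal_expansion_span[OF e, of "e i"] that orth
    by (simp add: P_def inner_add_left span_base)
  then have "e ` {..<d} \<subseteq> P ` W" using eW PT by (metis image_eqI image_subsetI lessThan_iff)
  then have "Z \<subseteq> P ` W"
    unfolding Z using linear_subspace_image[OF \<open>linear P\<close> W] by (rule span_minimal)
  then have dW: "d \<le> dim W"
    using dim_subset[of Z "P ` W"] dim_image_le[OF \<open>linear P\<close>, of W] dZ by simp
  have min: "min (dim W) (dim Z) = d" using dW dZ by simp
  obtain x y where xy: "principal_vectors W Z x y"
    and \<Theta>: "\<Theta> = map (\<lambda>k. arccos (x k \<bullet> y k)) [0..<d]"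
    unfolding \<Theta>_def canonical_angles_def min
    using someI_ex[of "\<lambda>\<theta>. \<exists>x y. principal_vectors W Z x y \<and> \<theta> = map (\<lambda>k. arccos (x k \<bullet> y k)) [0..<d]"]
      principal_vectors_exist[OF W sZ] by blast
  note unit = principal_vectors_unit[OF xy, unfolded min]
  note oy = principal_vectors_orthonormal(2)[OF xy, unfolded min]
  note proj = principal_vectors_projection[OF W sZ xy, unfolded min]
  define L where "L z = (\<Sum>i<d. (z \<bullet> e i) *\<^sub>R t i)" for z
  have "linear L"
    unfolding L_def by (rule linearI) (simp_all add: inner_add_left scaleR_sum_right sum.distrib algebra_simps)
  define c where "c k = x k \<bullet> y k" for k
  have LZ: "L z \<bullet> v = 0" if "v \<in> Z" for z v
  proof -
    have "orthogonal (L z) v"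
      by (rule orthogonal_to_span[OF that[unfolded Z]])
        (use orth in \<open>auto simp: orthogonal_def L_def inner_sum_left intro!: sum.neutral\<close>)
    then show ?thesis by (simp add: orthogonal_def)
  qed
  have graph: "z + L z \<in> W" if "z \<in> Z" for z
  proof -
    have "z + L z = (\<Sum>i<d. (z \<bullet> e i) *\<^sub>R (e i + t i))"
      using orthonormal_expansion_span[OF e _ that[unfolded Z]]
      by (simp add: L_def scaleR_add_right sum.distrib)
    then show ?thesis using eW by (auto intro!: subspace_sum subspace_scale W)
  qed
  have nyL: "(norm (z + L z))\<^sup>2 = (norm z)\<^sup>2 + (norm (L z))\<^sup>2" if "z \<in> Z" for z
    using LZ[OF that, of z]
    by (simp add: power2_norm_eq_inner inner_add_left inner_add_right inner_commute)
  have yk: "y k \<bullet> y k = 1" if "k < d" for k using unit(4)[OF that] by (simp add: norm_eq_1)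
  have c1: "c k \<le> 1" if "k < d" for k
    using norm_cauchy_schwarz[of "x k" "y k"] unit[OF that] by (simp add: c_def)
  have one: "1 = c k * ((y k + L (y k)) \<bullet> x k)" if "k < d" for k
  proof -
    have "(y k + L (y k)) \<bullet> y k = c k * ((y k + L (y k)) \<bullet> x k)"
      using proj[OF that] graph[OF unit(2)[OF that]] by (simp add: c_def)
    then show ?thesis using LZ[OF unit(2)[OF that]] yk[OF that] by (simp add: inner_add_left)
  qed
  have c0: "c k > 0" if "k < d" for k
  proof -
    have k: "k < min (dim W) (dim Z)" using that min by simp
    have "x i \<bullet> x k = 0 \<and> y i \<bullet> - y k = 0" if "i < k" for i
      using xy k that unfolding principal_vectors_def by auto
    moreover have "- y k \<in> Z" "norm (- y k) = 1"
      using unit[OF that] sZ by (simp_all add: subspace_neg)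
    ultimately have "x k \<bullet> (- y k) \<le> x k \<bullet> y k"
      using xy k unit[OF that] unfolding principal_vectors_def by blast
    then have "c k \<ge> 0" by (simp add: c_def)
    moreover have "c k \<noteq> 0" using one[OF that] by auto
    ultimately show ?thesis by simp
  qed
  have tan: "(tan (arccos (c k)))\<^sup>2 = 1 / (c k)\<^sup>2 - 1" if "k < d" for k
    using tan_arccos_sq c0 c1 that by blast
  have sum: "(\<Sum>\<theta>\<leftarrow>\<Theta>. (tan \<theta>)\<^sup>2) = (\<Sum>k<d. (tan (arccos (c k)))\<^sup>2)"
    by (simp add: \<Theta> c_def o_def interv_sum_list_conv_sum_set_nat atLeast0LessThan)
  \<comment> \<open>the Frobenius norm of \<open>L\<close> is the same in the orthonormal bases \<open>y\<close> and \<open>e\<close>\<close>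
  have HS: "(\<Sum>k<d. (norm (L (y k)))\<^sup>2) = (\<Sum>i<d. (norm (t i))\<^sup>2)"
  proof -
    have "span (y ` {..<d}) = Z"
      using unit(2) by (intro orthonormal_spans[OF oy sZ]) (auto simp: dZ)
    then have ee: "(\<Sum>k<d. (y k \<bullet> e i) * (y k \<bullet> e j)) = (if i = j then 1 else 0)"
      if "i < d" "j < d" for i j
      using orthonormal_parseval[OF oy, of "e i" "e j"] orthonormal_onD[OF e, of i j] that
      by (simp add: Z span_base inner_commute)
    have "(\<Sum>k<d. (norm (L (y k)))\<^sup>2)
      = (\<Sum>k<d. \<Sum>i<d. \<Sum>j<d. (y k \<bullet> e i) * (y k \<bullet> e j) * (t i \<bullet> t j))"
      unfolding power2_norm_eq_inner L_def inner_sum_left inner_scaleR_left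
      unfolding inner_sum_right inner_scaleR_right sum_distrib_left by (simp add: mult_ac)
    also have "\<dots> = (\<Sum>i<d. \<Sum>j<d. (\<Sum>k<d. (y k \<bullet> e i) * (y k \<bullet> e j)) * (t i \<bullet> t j))"
      unfolding sum_distrib_right by (subst sum.swap, rule sum.cong[OF refl], subst sum.swap) simp
    also have "\<dots> = (\<Sum>i<d. \<Sum>j<d. if i = j then t i \<bullet> t j else 0)"
      by (intro sum.cong refl) (simp add: ee)
    finally show ?thesis by (simp add: power2_norm_eq_inner)
  qed
  have le: "1 / (c k)\<^sup>2 - 1 \<le> (norm (L (y k)))\<^sup>2" if "k < d" for k
  proof -
    have "1 \<le> c k * norm (y k + L (y k))"
      using one[OF that] norm_cauchy_schwarz[of "y k + L (y k)" "x k"] unit(3)[OF that] c0[OF that]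
      by (metis mult.right_neutral mult_left_mono less_imp_le)
    then have "1\<^sup>2 \<le> (c k * norm (y k + L (y k)))\<^sup>2" by (intro power_mono) auto
    then show ?thesis
      using c0[OF that] nyL[OF unit(2)[OF that]] unit(4)[OF that]
      by (simp add: power_mult_distrib field_simps)
  qed
  show "pi / 2 \<notin> set \<Theta>"
  proof
    assume "pi / 2 \<in> set \<Theta>"
    then obtain k where "k < d" "arccos (c k) = pi / 2" by (auto simp: \<Theta> c_def)
    moreover from this have "cos (arccos (c k)) = 0" by (simp only: cos_pi_half)
    ultimately show False using c0[of k] c1[of k] by simp
  qed
  show "(\<Sum>\<theta>\<leftarrow>\<Theta>. (tan \<theta>)\<^sup>2) \<le> (\<Sum>i<d. (norm (t i))\<^sup>2)"
    unfolding sum HS[symmetric] by (intro sum_mono) (simp add: tan le)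
  show "(\<Sum>\<theta>\<leftarrow>\<Theta>. (tan \<theta>)\<^sup>2) = (\<Sum>i<d. (norm (t i))\<^sup>2)"
    if WL: "W = span ((\<lambda>i. e i + t i) ` {..<d})"
  proof -
    have Lt: "L (e i) = t i" if "i < d" for i
    proof -
      have "L (e i) = (\<Sum>k<d. if k = i then t i else 0)"
        unfolding L_def using that by (intro sum.cong) (auto simp: orthonormal_onD[OF e])
      then show ?thesis using that by simp
    qed
    have Wgraph: "w = P w + L (P w)" if "w \<in> W" for w
    proof (rule linear_eq_on[OF linear_ident])
      show "linear (\<lambda>w. P w + L (P w))"
        using linear_compose[OF \<open>linear P\<close> \<open>linear L\<close>] \<open>linear P\<close>
        by (intro linear_compose_add) (auto simp: o_def)
    qed (use that WL PT Lt in auto)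
    have "1 / (c k)\<^sup>2 - 1 = (norm (L (y k)))\<^sup>2" if k: "k < d" for k
    proof -
      have "x k \<bullet> e i = c k * (y k \<bullet> e i)" if "i < d" for i
        using proj[OF k] that by (simp add: Z span_base c_def)
      then have "P (x k) = c k *\<^sub>R (\<Sum>i<d. (y k \<bullet> e i) *\<^sub>R e i)"
        by (simp add: P_def scaleR_sum_right)
      also have "(\<Sum>i<d. (y k \<bullet> e i) *\<^sub>R e i) = y k"
        using orthonormal_expansion_span[OF e] unit(2)[OF k] Z by simp
      finally have "x k = c k *\<^sub>R (y k + L (y k))"
        using Wgraph[OF unit(1)[OF k]]
        by (simp add: linear_cmul[OF \<open>linear L\<close>] scaleR_add_right)
      then have "1 = c k * norm (y k + L (y k))"
        using unit(3)[OF k] c0[OF k] by (metis abs_of_pos norm_scaleR)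
      then have "1\<^sup>2 = (c k * norm (y k + L (y k)))\<^sup>2" by simp
      then show ?thesis
        using c0[OF k] nyL[OF unit(2)[OF k]] unit(4)[OF k]
        by (simp add: power_mult_distrib field_simps)
    qed
    then show ?thesis unfolding sum HS[symmetric] by (simp add: tan)
  qed
qed

section \<open>Chebyshev polynomials\<close>

lemma chebyshev_is_poly: "\<exists>p. degree p \<le> k \<and> (\<forall>x. poly p x = chebyshev k x)"
proof (induction k rule: induct_nat_012)
  case 0 show ?case by (intro exI[of _ 1]) simp
next
  case 1 show ?case by (intro exI[of _ "[:0, 1:]"]) simp
next
  case (ge2 k)
  then obtain p q where p: "degree p \<le> Suc k" "\<And>x. poly p x = chebyshev (Suc k) x"
    and q: "degree q \<le> k" "\<And>x. poly q x = chebyshev k x" by blast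
  have "degree ([:0, 2:] * p - q) \<le> Suc (Suc k)"
    using p(1) q(1) degree_mult_le[of "[:0, 2:]" p] by (intro degree_diff_le) auto
  then show ?case by (intro exI[of _ "[:0, 2:] * p - q"]) (simp add: p q)
qed

lemma chebyshev_cos: "chebyshev k (cos t) = cos (real k * t)"
proof (induction k "cos t" rule: chebyshev.induct)
  case (3 k)
  have "cos (real (Suc (Suc k)) * t) + cos (real k * t) = 2 * cos t * cos (real (Suc k) * t)"
    using cos_plus_cos[of "real (Suc (Suc k)) * t" "real k * t"]
    by (simp add: algebra_simps add_divide_distrib)
  then show ?case using 3 by simp
qed auto

lemma abs_chebyshev_le_1: "\<bar>x\<bar> \<le> 1 \<Longrightarrow> \<bar>chebyshev k x\<bar> \<le> 1"
  using chebyshev_cos[of k "arccos x"] by (simp add: cos_arccos_abs)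

lemma chebyshev_ge_1:
  assumes x: "1 \<le> x" shows "1 \<le> chebyshev k x"
proof -
  have "1 \<le> chebyshev k x \<and> chebyshev k x \<le> chebyshev (Suc k) x" for k
  proof (induction k)
    case (Suc k)
    have "2 * chebyshev (Suc k) x \<le> 2 * x * chebyshev (Suc k) x"
      using Suc mult_right_mono[OF x, of "chebyshev (Suc k) x"] by linarith
    then show ?case using Suc unfolding chebyshev.simps by linarith
  qed (use x in simp)
  then show ?thesis by blast
qed

text \<open>The polynomial is the product of the linear factors \<open>(c i - x) / (c i - c j)\<close>, \<open>i < j\<close>, which
  remove the nodes before \<open>c j\<close>, and a Chebyshev polynomial of degree \<open>m - j\<close>, transplanted from
  \<open>[-1, 1]\<close> to the interval \<open>[c l, c (j + 1)]\<close> of the nodes after \<open>c j\<close> and normalised at \<open>c j\<close>. On that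
  interval the linear factors are largest at \<open>c l\<close>, where their product is \<open>\<eta>\<close>, and the Chebyshev
  polynomial is at most \<open>1\<close> in modulus, while before the normalisation it is
  \<open>chebyshev (m - j) \<xi>\<close> at \<open>c j\<close>.\<close>
lemma filter_polynomial:
  fixes c :: "nat \<Rightarrow> real"
  assumes dec: "\<And>i k. i \<in> {1..l} \<Longrightarrow> k \<in> {1..l} \<Longrightarrow> i < k \<Longrightarrow> c k < c i"
    and j: "1 \<le> j" "j \<le> m" and m: "m < l"
  defines "\<eta> \<equiv> \<Prod>i=1..j-1. (c i - c l) / (c i - c j)"
    and "\<xi> \<equiv> 1 + 2 * ((c j - c (j + 1)) / (c (j + 1) - c l))"
  shows "\<exists>f. degree f < m \<and> poly f (c j) = 1 \<and> 0 \<le> \<eta> / chebyshev (m - j) \<xi> \<and>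
    (\<forall>i\<in>{1..l}. i \<noteq> j \<longrightarrow> \<bar>poly f (c i)\<bar> \<le> \<eta> / chebyshev (m - j) \<xi>)"
proof -
  define T where "T = chebyshev (m - j) \<xi>"
  obtain p where p: "degree p \<le> m - j" "\<And>x. poly p x = chebyshev (m - j) x"
    using chebyshev_is_poly by blast
  define y where "y x = 1 + 2 * ((x - c (j + 1)) / (c (j + 1) - c l))" for x
  define a where "a = [:1 - 2 * c (j + 1) / (c (j + 1) - c l), 2 / (c (j + 1) - c l):]"
  have a: "poly a x = y x" for x by (simp add: a_def y_def diff_divide_distrib algebra_simps)
  define g where "g = (\<Prod>i=1..j-1. smult (1 / (c i - c j)) [:c i, -1:])"
  have g: "poly g x = (\<Prod>i=1..j-1. (c i - x) / (c i - c j))" for x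
    by (simp add: g_def poly_prod diff_divide_distrib)
  have cij: "c j < c i" if "i \<in> {1..j-1}" for i using that j m by (intro dec) auto
  \<comment> \<open>The case \<open>j = m\<close> is separate here and below: then \<open>c (j + 1) = c l\<close> is possible, so that \<open>y\<close> and
    \<open>\<xi>\<close> divide by zero, but \<open>chebyshev 0\<close> is constant.\<close>
  have T1: "T \<ge> 1"
  proof (cases "j = m")
    case False
    then have "c l < c (j + 1)" "c (j + 1) < c j" using j m by (auto intro!: dec)
    then show ?thesis unfolding T_def \<xi>_def by (intro chebyshev_ge_1) simp
  qed (simp add: T_def)
  define f where "f = smult (1 / T) (g * pcompose p a)"
  have f: "poly f x = poly g x * chebyshev (m - j) (y x) / T" for x
    by (simp add: f_def poly_pcompose p a)
  have degg: "degree g \<le> j - 1"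
  proof -
    have "degree g \<le> (\<Sum>i=1..j-1. degree (smult (1 / (c i - c j)) [:c i, -1:]))"
      unfolding g_def by (rule order.trans[OF degree_prod_sum_le]) (simp_all only: finite_atLeastAtMost o_def order.refl)
    also have "\<dots> \<le> (\<Sum>i=1..j-1. 1)"
      by (intro sum_mono order.trans[OF degree_smult_le]) simp
    finally show ?thesis by simp
  qed
  have dega: "degree (pcompose p a) \<le> m - j"
  proof -
    have "degree a \<le> 1" by (simp add: a_def)
    then have "degree p * degree a \<le> (m - j) * 1" using p(1) by (intro mult_mono) auto
    then show ?thesis using degree_pcompose_le[of p a] by simp
  qed
  have "degree f \<le> (j - 1) + (m - j)"
    unfolding f_def using degree_smult_le degree_mult_le[of g "pcompose p a"] degg dega
    by (meson add_mono order.trans)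
  then have deg: "degree f < m" using j by simp
  have "poly g (c j) = 1"
    unfolding g by (intro prod.neutral) (use cij in force)
  moreover have "y (c j) = \<xi>" by (simp add: y_def \<xi>_def)
  ultimately have fj: "poly f (c j) = 1" using T1 by (simp add: f T_def)
  have eta0: "0 \<le> \<eta>"
    unfolding \<eta>_def
  proof (intro prod_nonneg)
    fix i assume i: "i \<in> {1..j-1}"
    then have "c l < c i" using j m by (intro dec) auto
    then show "0 \<le> (c i - c l) / (c i - c j)" using cij[OF i] by simp
  qed
  have bound: "\<bar>poly f (c i)\<bar> \<le> \<eta> / T" if i: "i \<in> {1..l}" "i \<noteq> j" for i
  proof (cases "i < j")
    case True
    then have "poly g (c i) = 0"
      unfolding g using i by (intro prod_zero) auto
    then show ?thesis using eta0 T1 by (simp add: f)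
  next
    case False
    then have ij: "j < i" using i by simp
    have le: "c l \<le> c i" using dec[of i l] i by (cases "i = l") auto
    have "\<bar>poly g (c i)\<bar> \<le> \<eta>"
      unfolding g \<eta>_def abs_prod
    proof (intro prod_mono conjI)
      fix k assume k: "k \<in> {1..j-1}"
      have "c i < c k" using k ij i by (intro dec) auto
      then show "\<bar>(c k - c i) / (c k - c j)\<bar> \<le> (c k - c l) / (c k - c j)"
        using le cij[OF k] by (simp add: divide_right_mono)
    qed simp
    moreover have "\<bar>chebyshev (m - j) (y (c i))\<bar> \<le> 1"
    proof (cases "j = m")
      case jm: False
      have 1: "c l < c (j + 1)" using jm j m by (intro dec) auto
      have "c i \<le> c (j + 1)" using ij i dec[of "j + 1" i] by (cases "i = j + 1") auto
      then have "\<bar>y (c i)\<bar> \<le> 1"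
        using 1 le by (auto simp: y_def abs_le_iff field_simps)
      then show ?thesis by (rule abs_chebyshev_le_1)
    qed simp
    ultimately have "\<bar>poly g (c i)\<bar> * \<bar>chebyshev (m - j) (y (c i))\<bar> \<le> \<eta> * 1"
      by (intro mult_mono) (use eta0 in auto)
    then show ?thesis using T1 by (simp add: f abs_mult divide_right_mono)
  qed
  show ?thesis
    using deg fj bound eta0 T1 unfolding T_def[symmetric] by (intro exI[of _ f]) auto
qed

section \<open>The effect of a spectral filter on the angles\<close>

text \<open>The vectors \<open>R c i\<close> are the components of the \<open>c\<close>-th basis vector of \<open>W\<close> in mutually
  orthogonal subspaces, indexed by \<open>i\<close>, and \<open>Z\<close> is the subspace with index \<open>k\<close>. Since \<open>Z\<close> has the
  orthogonal basis \<open>R c k\<close>, the subspace \<open>W\<close> is the graph over \<open>Z\<close> of a map that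
  sends \<open>R c k\<close> to the sum of the other components, and its squared Frobenius norm is the sum over
  \<open>c\<close> and \<open>i \<noteq> k\<close> of \<open>(norm (R c i))\<^sup>2 / (norm (R c k))\<^sup>2\<close>. Multiplying the components by \<open>f i\<close> keeps
  the base points \<open>R c k\<close> of the graph and multiplies every term of this sum by at most \<open>C\<^sup>2\<close>.\<close>
lemma frobenius_tan_filter:
  fixes R :: "nat \<Rightarrow> 'i \<Rightarrow> 'a::euclidean_space"
  assumes I: "finite I" "k \<in> I"
    and orth: "\<And>i i' c c'. \<lbrakk>i \<in> I; i' \<in> I; i \<noteq> i'; c < d; c' < d\<rbrakk> \<Longrightarrow> R c i \<bullet> R c' i' = 0"
    and orth_k: "\<And>c c'. \<lbrakk>c < d; c' < d; c \<noteq> c'\<rbrakk> \<Longrightarrow> R c k \<bullet> R c' k = 0"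
    and nz: "\<And>c. c < d \<Longrightarrow> R c k \<noteq> 0"
    and Z: "subspace Z" "\<And>c. c < d \<Longrightarrow> R c k \<in> Z" "dim Z \<le> d"
    and W: "W = span ((\<lambda>c. \<Sum>i\<in>I. R c i) ` {..<d})"
    and W': "subspace W'" "\<And>c. c < d \<Longrightarrow> (\<Sum>i\<in>I. f i *\<^sub>R R c i) \<in> W'"
    and f: "f k = 1" "\<And>i. i \<in> I \<Longrightarrow> i \<noteq> k \<Longrightarrow> \<bar>f i\<bar> \<le> C" and C: "0 \<le> C"
  shows "frobenius_tan W' Z \<le> ereal C * frobenius_tan W Z"
proof -
  define n where "n c = norm (R c k)" for c
  define e where "e c = R c k /\<^sub>R n c" for c
  define t where "t g c = (\<Sum>i\<in>I - {k}. g i *\<^sub>R R c i) /\<^sub>R n c" for g :: "'i \<Rightarrow> real" and c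
  have n: "n c > 0" if "c < d" for c using nz[OF that] by (simp add: n_def)
  have e: "orthonormal_on {..<d} e"
    unfolding orthonormal_on_def
  proof (intro ballI)
    fix c c' assume c: "c \<in> {..<d}" "c' \<in> {..<d}"
    have "norm (e c) = 1" using c nz by (simp add: e_def n_def)
    then show "e c \<bullet> e c' = (if c = c' then 1 else 0)"
      using c orth_k[of c c'] by (auto simp: norm_eq_1) (simp add: e_def)
  qed
  have Ze: "Z = span (e ` {..<d})"
    using Z by (intro orthonormal_spans[symmetric] e) (auto simp: e_def subspace_scale)
  have te: "t g c \<bullet> e c' = 0" if "c < d" "c' < d" for g c c'
    using orth that I by (auto simp: t_def e_def inner_sum_left intro!: sum.neutral)
  have et: "e c + t g c = (\<Sum>i\<in>I. g i *\<^sub>R R c i) /\<^sub>R n c" if "g k = 1" for g c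
    using that by (simp add: e_def t_def sum.remove[OF I] scaleR_add_right)
  have nt: "(norm (t g c))\<^sup>2 = (\<Sum>i\<in>I - {k}. (g i)\<^sup>2 * (norm (R c i))\<^sup>2) / (n c)\<^sup>2" if "c < d" for g c
  proof -
    have "(norm (\<Sum>i\<in>I - {k}. g i *\<^sub>R R c i))\<^sup>2 = (\<Sum>i\<in>I - {k}. (norm (g i *\<^sub>R R c i))\<^sup>2)"
      using I orth that
      by (intro norm_sum_Pythagorean) (auto simp: pairwise_def orthogonal_def)
    then show ?thesis
      by (simp add: t_def power_mult_distrib n_def divide_inverse power_inverse mult.commute)
  qed
  have eW': "e c + t f c \<in> W'" if "c < d" for c
    using W' that by (simp add: et f subspace_scale)
  have We: "W = span ((\<lambda>c. e c + t (\<lambda>_. 1) c) ` {..<d})"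
  proof
    have "(\<Sum>i\<in>I. R c i) = n c *\<^sub>R (e c + t (\<lambda>_. 1) c)" if "c < d" for c
      using n[OF that] by (simp add: et)
    then show "W \<subseteq> span ((\<lambda>c. e c + t (\<lambda>_. 1) c) ` {..<d})"
      unfolding W by (intro span_minimal) (auto intro!: span_scale intro: span_base)
    show "span ((\<lambda>c. e c + t (\<lambda>_. 1) c) ` {..<d}) \<subseteq> W"
      unfolding W by (intro span_minimal) (auto simp: et intro!: span_scale intro: span_base)
  qed
  have eW: "e c + t (\<lambda>_. 1) c \<in> W" if "c < d" for c
    unfolding We using that by (auto intro: span_base)
  have sW: "subspace W" by (simp add: W)
  note angles' = canonical_angles_tan[OF W'(1) e Ze te eW']
  note angles = canonical_angles_tan[OF sW e Ze te eW]
  have "(norm (t f c))\<^sup>2 \<le> C\<^sup>2 * (norm (t (\<lambda>_. 1) c))\<^sup>2" if "c < d" for c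
  proof -
    have "(\<Sum>i\<in>I - {k}. (f i)\<^sup>2 * (norm (R c i))\<^sup>2) \<le> (\<Sum>i\<in>I - {k}. C\<^sup>2 * (norm (R c i))\<^sup>2)"
      using f(2) C by (intro sum_mono mult_right_mono) (auto simp: abs_le_square_iff[symmetric])
    then show ?thesis
      using n[OF that] by (simp add: nt[OF that] sum_distrib_left[symmetric] divide_right_mono)
  qed
  then have "(\<Sum>c<d. (norm (t f c))\<^sup>2) \<le> C\<^sup>2 * (\<Sum>c<d. (norm (t (\<lambda>_. 1) c))\<^sup>2)"
    unfolding sum_distrib_left by (intro sum_mono) simp
  then have "(\<Sum>\<theta>\<leftarrow>canonical_angles W' Z. (tan \<theta>)\<^sup>2) \<le> C\<^sup>2 * (\<Sum>\<theta>\<leftarrow>canonical_angles W Z. (tan \<theta>)\<^sup>2)"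
    using angles'(2) angles(3)[OF _ _ _ We] by simp
  then have "sqrt (\<Sum>\<theta>\<leftarrow>canonical_angles W' Z. (tan \<theta>)\<^sup>2)
      \<le> C * sqrt (\<Sum>\<theta>\<leftarrow>canonical_angles W Z. (tan \<theta>)\<^sup>2)"
    using C by (metis real_sqrt_le_mono real_sqrt_mult real_sqrt_abs abs_of_nonneg)
  then show ?thesis
    using angles'(1) angles(1) by (simp add: frobenius_tan_def)
qed

section \<open>Spectral decomposition of the pencil\<close>

lemma inner_B_linear:
  "inner_B B (x + y) z = inner_B B x z + inner_B B y z"
  "inner_B B x (y + z) = inner_B B x y + inner_B B x z"
  "inner_B B (c *\<^sub>R x) y = c * inner_B B x y"
  "inner_B B x (c *\<^sub>R y) = c * inner_B B x y"
  by (simp_all add: inner_B_def inner_add_left inner_add_right matrix_vector_right_distrib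
      matrix_vector_mult_scaleR)

lemma inner_B_commute: "sym_pos_def B \<Longrightarrow> inner_B B x y = inner_B B y x"
  by (simp add: inner_B_eq_inner_sqrt inner_commute)

lemma sym_pos_def_inj: "sym_pos_def B \<Longrightarrow> inj ((*v) B)"
  unfolding linear_injective_0[OF matrix_vector_mul_linear]
  by (metis inner_zero_right less_irrefl sym_pos_def_def)

lemma sym_pos_def_matrix_inv:
  assumes "sym_pos_def (B :: real^'n^'n)"
  shows "B ** matrix_inv B = mat 1 \<and> matrix_inv B ** B = mat 1"
proof -
  have "\<exists>B'. B' ** B = mat 1"
    using sym_pos_def_inj[OF assms] matrix_left_invertible_injective by blast
  then have "\<exists>B'. B ** B' = mat 1 \<and> B' ** B = mat 1" using matrix_left_right_inverse by blast
  then show ?thesis unfolding matrix_inv_def by (rule someI_ex)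
qed

text \<open>The inverse of \<open>B\<close> cancels the matrix \<open>B\<close> of the inner product and leaves the skew-symmetric
  matrix \<open>A\<close>.\<close>
lemma skew_adjoint_inner_B:
  assumes skew: "skew_symmetric A" and spd: "sym_pos_def B"
  shows "inner_B B ((matrix_inv B ** A) *v x) y = - inner_B B x ((matrix_inv B ** A) *v y)"
proof -
  have BK: "B *v ((matrix_inv B ** A) *v z) = A *v z" for z
    by (simp add: matrix_vector_mul_assoc matrix_mul_assoc sym_pos_def_matrix_inv[OF spd])
  have "inner_B B ((matrix_inv B ** A) *v x) y = (A *v x) \<bullet> y"
    using inner_B_commute[OF spd] BK by (metis inner_B_def inner_commute)
  also have "\<dots> = x \<bullet> (transpose A *v y)"
    by (metis dot_lmul_matrix inner_commute transpose_matrix_vector)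
  also have "\<dots> = - (x \<bullet> (A *v y))"
    using skew by (simp add: skew_symmetric_def matrix_vector_mult_def vec_eq_iff inner_vec_def sum_negf)
  finally show ?thesis by (simp add: inner_B_def BK)
qed

lemma linear_funpow:
  fixes f :: "'a::real_vector \<Rightarrow> 'a"
  assumes "linear f" shows "linear (f ^^ r)"
  by (induction r) (simp_all add: linear_id linear_compose[OF _ assms, unfolded o_def] id_def[symmetric] o_def)

lemma sum_spaceI1: "0 \<in> V \<Longrightarrow> x \<in> U \<Longrightarrow> x \<in> sum_space U V"
  unfolding sum_space_def using add.right_neutral[of x, symmetric] by blast

lemma sum_spaceI2: "0 \<in> U \<Longrightarrow> y \<in> V \<Longrightarrow> y \<in> sum_space U V"
  unfolding sum_space_def using add.left_neutral[of y, symmetric] by blast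

lemma krylov_poly_mem:
  "degree f < m \<Longrightarrow> (\<Sum>r\<le>degree f. coeff f r *\<^sub>R (((*v) C) ^^ r) b) \<in> krylov m C b"
  unfolding krylov_def by (intro span_sum span_scale span_base) auto

lemma two_cols_axis:
  "two_cols x y *v axis 1 1 = x" "two_cols x y *v axis 2 1 = y"
  by (simp_all add: matrix_vector_mult_basis column_def two_cols_def vec_eq_iff)

lemma transpose_two_cols_mult_eq_0:
  assumes "x \<bullet> z = 0" "y \<bullet> z = 0"
  shows "transpose (two_cols x y) *v z = 0"
  unfolding vec_eq_iff
proof
  fix i :: 2
  show "(transpose (two_cols x y) *v z) $ i = 0 $ i"
    using assms
    by (cases "i = 1") (simp_all add: matrix_vector_mult_def transpose_def two_cols_def inner_vec_def)
qed

text \<open>Let \<open>\<pi> i\<close> be the \<open>B\<close>-orthogonal projection onto the span of \<open>u i\<close> and \<open>v i\<close>. It commutes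
  with \<open>K\<close>, and \<open>K ** K\<close> acts as \<open>- (\<sigma> i)\<^sup>2\<close> on its image. On the range of \<open>K\<close> the projections sum to the
  identity, so \<open>p\<close> and \<open>q\<close> are the sums of their components, and applying \<open>f (K ** K)\<close>, which
  leads into the Krylov spaces, multiplies the components with index \<open>i\<close> by \<open>poly f (- (\<sigma> i)\<^sup>2)\<close>. The
  filter estimate applies because the components of \<open>p\<close> and \<open>q\<close> of index \<open>k\<close> are an
  orthogonal basis of the eigenspace: \<open>p\<close> is a multiple of \<open>K *v q\<close> and \<open>K\<close> maps each vector
  of the eigenspace to a \<open>B\<close>-orthogonal one. They are nonzero by the nonsingularity assumption.\<close>
lemma pencil_angle_bound:
  fixes A B :: "real^'n^'n" and \<sigma> :: "nat \<Rightarrow> real" and u v :: "nat \<Rightarrow> real^'n"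
  assumes skew: "skew_symmetric A" and spd: "sym_pos_def B" and rank: "2 * l = rank A"
    and sigma: "\<And>i. i \<in> {1..l} \<Longrightarrow> \<sigma> i \<noteq> 0"
    and A_v: "\<And>i. i \<in> {1..l} \<Longrightarrow> A *v v i = \<sigma> i *\<^sub>R (B *v u i)"
    and A_u: "\<And>i. i \<in> {1..l} \<Longrightarrow> A *v u i = - \<sigma> i *\<^sub>R (B *v v i)"
    and uu: "\<And>i k. i \<in> {1..l} \<Longrightarrow> k \<in> {1..l} \<Longrightarrow>
          inner_B B (u i) (u k) = (if i = k then 1 else 0)"
    and vv: "\<And>i k. i \<in> {1..l} \<Longrightarrow> k \<in> {1..l} \<Longrightarrow>
          inner_B B (v i) (v k) = (if i = k then 1 else 0)"
    and uv: "\<And>i k. i \<in> {1..l} \<Longrightarrow> k \<in> {1..l} \<Longrightarrow> inner_B B (u i) (v k) = 0"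
  defines "K \<equiv> matrix_inv B ** A"
  assumes q: "q \<in> range ((*v) K)" and p: "p = c *\<^sub>R (K *v q)"
    and k: "k \<in> {1..l}"
    and inv: "invertible (transpose (two_cols (u k) (v k)) ** B ** two_cols p q)"
    and f: "degree f < m" "poly f (- (\<sigma> k)\<^sup>2) = 1"
    and C: "0 \<le> C" "\<And>i. i \<in> {1..l} \<Longrightarrow> i \<noteq> k \<Longrightarrow> \<bar>poly f (- (\<sigma> i)\<^sup>2)\<bar> \<le> C"
  shows "tan_angles_frobenius B (sum_space (krylov m (K ** K) p) (krylov m (K ** K) q)) (span {u k, v k})
    \<le> ereal C * tan_angles_frobenius B (span {p, q}) (span {u k, v k})"
proof -
  define M where "M = sqrt_matrix B"
  note ip = inner_B_eq_inner_sqrt[OF spd, folded M_def]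
  have linM: "linear ((*v) M)" by simp
  have injM: "M *v x = M *v y \<Longrightarrow> x = y" for x y
    using sym_pos_def_inj[OF sqrt_matrix(1)[OF spd]] by (simp add: M_def inj_eq)
  have invB: "matrix_inv B *v (B *v x) = x" for x
    by (simp add: matrix_vector_mul_assoc sym_pos_def_matrix_inv[OF spd])
  have Kv: "K *v v i = \<sigma> i *\<^sub>R u i" and Ku: "K *v u i = - \<sigma> i *\<^sub>R v i" if "i \<in> {1..l}" for i
    using A_v[OF that] A_u[OF that]
    by (simp_all add: K_def matrix_vector_mul_assoc[symmetric] matrix_vector_mult_scaleR invB
        linear_neg[OF matrix_vector_mul_linear])
  have vu: "inner_B B (v i) (u k) = 0" if "i \<in> {1..l}" "k \<in> {1..l}" for i k
    using uv[OF that(2,1)] inner_B_commute[OF spd] by simp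
  define \<pi> where "\<pi> i x = inner_B B x (u i) *\<^sub>R u i + inner_B B x (v i) *\<^sub>R v i" for i x
  \<comment> \<open>The images under \<open>M\<close> of the \<open>2 l\<close> vectors \<open>u i\<close>, \<open>v i\<close> are orthonormal. As \<open>2 l\<close> is the rank of
    \<open>A\<close>, they span the image of the range of \<open>K\<close>.\<close>
  have expand: "x = (\<Sum>i=1..l. \<pi> i x)" if x: "x \<in> range ((*v) K)" for x
  proof -
    define w where "w = (\<lambda>(b, i). M *v (if b then u i else v i))"
    define J where "J = (UNIV :: bool set) \<times> {1..l}"
    have w: "orthonormal_on J w"
      using uu vv uv vu by (auto simp: orthonormal_on_def J_def w_def ip[symmetric])
    have J: "finite J" "card J = rank A" by (simp_all add: J_def card_cartesian_product rank[symmetric])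
    have "span (w ` J) = (*v) M ` range ((*v) K)"
    proof (rule orthonormal_spans[OF w])
      show "subspace ((*v) M ` range ((*v) K))"
        by (intro linear_subspace_image linM subspace_UNIV) simp
      have "u i \<in> range ((*v) K)" "v i \<in> range ((*v) K)" if "i \<in> {1..l}" for i
      proof -
        have "u i = K *v ((1 / \<sigma> i) *\<^sub>R v i)" "v i = K *v ((- 1 / \<sigma> i) *\<^sub>R u i)"
          using sigma[OF that] Kv[OF that] Ku[OF that] unfolding matrix_vector_mult_scaleR by simp_all
        then show "u i \<in> range ((*v) K)" "v i \<in> range ((*v) K)" by (metis rangeI)+
      qed
      then show "w ` J \<subseteq> (*v) M ` range ((*v) K)" by (auto simp: w_def J_def)
      have "dim ((*v) M ` range ((*v) K)) \<le> rank K"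
        unfolding rank_dim_range by (intro dim_image_le linM)
      also have "\<dots> \<le> rank A" unfolding K_def by (rule rank_mul_le_right)
      finally show "dim ((*v) M ` range ((*v) K)) \<le> card J" by (simp add: J)
    qed
    then have "M *v x = (\<Sum>a\<in>J. ((M *v x) \<bullet> w a) *\<^sub>R w a)"
      using orthonormal_expansion_span[OF w J(1), of "M *v x"] x by blast
    also have "\<dots> = (\<Sum>i=1..l. M *v \<pi> i x)"
      by (simp add: J_def sum.cartesian_product' UNIV_bool w_def \<pi>_def ip
          matrix_vector_right_distrib matrix_vector_mult_scaleR sum.distrib add.commute)
    also have "\<dots> = M *v (\<Sum>i=1..l. \<pi> i x)" by (simp add: linear_sum[OF linM])
    finally show ?thesis by (rule injM)
  qed
  have KK: "(((*v) (K ** K)) ^^ r) (\<pi> i x) = (- (\<sigma> i)\<^sup>2) ^ r *\<^sub>R \<pi> i x" if "i \<in> {1..l}" for r i x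
  proof (induction r)
    case (Suc r)
    have "(K ** K) *v \<pi> i x = (- (\<sigma> i)\<^sup>2) *\<^sub>R \<pi> i x"
      using Kv[OF that] Ku[OF that]
      by (simp add: \<pi>_def matrix_vector_mul_assoc[symmetric] matrix_vector_right_distrib
          matrix_vector_mult_scaleR power2_eq_square algebra_simps
          linear_neg[OF matrix_vector_mul_linear])
    then show ?case using Suc by (simp add: matrix_vector_mult_scaleR mult.commute)
  qed simp
  have pK: "(\<Sum>i=1..l. poly f (- (\<sigma> i)\<^sup>2) *\<^sub>R \<pi> i x) \<in> krylov m (K ** K) x"
    if x: "x \<in> range ((*v) K)" for x
  proof -
    have "(\<Sum>r\<le>degree f. coeff f r *\<^sub>R (((*v) (K ** K)) ^^ r) x)
        = (\<Sum>r\<le>degree f. coeff f r *\<^sub>R (((*v) (K ** K)) ^^ r) (\<Sum>i=1..l. \<pi> i x))"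
      using expand[OF x] by simp
    also have "\<dots> = (\<Sum>r\<le>degree f. \<Sum>i=1..l. (coeff f r * (- (\<sigma> i)\<^sup>2) ^ r) *\<^sub>R \<pi> i x)"
      by (simp add: linear_sum[OF linear_funpow[OF matrix_vector_mul_linear]] KK scaleR_sum_right)
    also have "\<dots> = (\<Sum>i=1..l. poly f (- (\<sigma> i)\<^sup>2) *\<^sub>R \<pi> i x)"
      by (subst sum.swap) (simp add: poly_altdef scaleR_sum_left)
    finally show ?thesis using krylov_poly_mem[OF f(1), of "K ** K" x] by simp
  qed
  \<comment> \<open>the components of \<open>p\<close> (\<open>c = 0\<close>) and of \<open>q\<close>, carried over to the Euclidean inner product\<close>
  define R where "R c i = M *v \<pi> i (if c = 0 then p else q)" for c :: nat and i
  have pr: "p \<in> range ((*v) K)"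
    using p by (metis matrix_vector_mult_scaleR rangeI)
  have sumR: "(\<Sum>i=1..l. R c i) = M *v (if c = 0 then p else q)" for c
    using expand[OF pr] expand[OF q] unfolding R_def linear_sum[OF linM, symmetric] by simp
  have ipR: "R c i \<bullet> R c' i' = inner_B B (\<pi> i (if c = 0 then p else q)) (\<pi> i' (if c' = 0 then p else q))"
    for c c' i i' by (simp add: R_def ip)
  have ip\<pi>: "inner_B B (\<pi> i x) (\<pi> i' y) = (if i = i' then
      inner_B B x (u i) * inner_B B y (u i) + inner_B B x (v i) * inner_B B y (v i) else 0)"
    if "i \<in> {1..l}" "i' \<in> {1..l}" for i i' x y
    using that by (simp add: \<pi>_def inner_B_linear uu vv uv vu)
  have pu: "inner_B B p (u k) = c * \<sigma> k * inner_B B q (v k)"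
    and pv: "inner_B B p (v k) = - (c * \<sigma> k * inner_B B q (u k))"
    using skew_adjoint_inner_B[OF skew spd, folded K_def, of q] Ku[OF k] Kv[OF k]
    by (simp_all add: p inner_B_linear inner_B_linear(4)[of _ _ "- _", simplified])
  have orthk: "inner_B B (\<pi> k p) (\<pi> k q) = 0"
    by (simp add: ip\<pi>[OF k k] pu pv)
  \<comment> \<open>if \<open>p\<close> or \<open>q\<close> had no component in the eigenspace, the corresponding column of the matrix in
    \<open>inv\<close> would vanish\<close>
  have nz: "\<pi> k x \<noteq> 0" if x: "two_cols p q *v axis a 1 = x" for a x
  proof
    assume "\<pi> k x = 0"
    then have "inner_B B (\<pi> k x) (u k) = 0" "inner_B B (\<pi> k x) (v k) = 0" by (simp_all add: inner_B_def)
    then have "inner_B B x (u k) = 0" "inner_B B x (v k) = 0"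
      using k by (simp_all add: \<pi>_def inner_B_linear uu vv uv vu)
    then have "transpose (two_cols (u k) (v k)) *v (B *v x) = 0"
      using inner_B_commute[OF spd] by (intro transpose_two_cols_mult_eq_0) (metis inner_B_def)+
    then have "(transpose (two_cols (u k) (v k)) ** B ** two_cols p q) *v axis a 1 = 0"
      by (simp add: matrix_vector_mul_assoc[symmetric] x)
    then have "axis a (1::real) = 0"
      using inv by (metis invertible_def matrix_left_invertible_ker)
    then show False by (simp add: axis_eq_0_iff)
  qed
  have "frobenius_tan ((*v) M ` sum_space (krylov m (K ** K) p) (krylov m (K ** K) q)) ((*v) M ` span {u k, v k})
    \<le> ereal C * frobenius_tan ((*v) M ` span {p, q}) ((*v) M ` span {u k, v k})"
  proof (rule frobenius_tan_filter[where R = R and I = "{1..l}" and k = k and d = 2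
        and f = "\<lambda>i. poly f (- (\<sigma> i)\<^sup>2)"])
    show "R c i \<bullet> R c' i' = 0" if "i \<in> {1..l}" "i' \<in> {1..l}" "i \<noteq> i'" for i i' c c'
      using that by (simp add: ipR ip\<pi>)
    show "R c k \<bullet> R c' k = 0" if "c < 2" "c' < 2" "c \<noteq> c'" for c c'
      using that orthk inner_B_commute[OF spd] by (auto simp: ipR less_2_cases_iff)
    show "R c k \<noteq> 0" for c
      using nz[OF two_cols_axis(1)] nz[OF two_cols_axis(2)] injM[of _ 0] by (auto simp: R_def)
    show "subspace ((*v) M ` span {u k, v k})" by (intro linear_subspace_image linM subspace_span)
    show "R c k \<in> (*v) M ` span {u k, v k}" for c
      unfolding R_def \<pi>_def by (intro imageI span_add span_scale span_base) auto
    have "dim ((*v) M ` span {u k, v k}) \<le> dim (span {u k, v k})" by (intro dim_image_le linM)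
    also have "\<dots> \<le> card {u k, v k}" by (simp add: dim_le_card')
    also have "\<dots> \<le> 2" by (simp add: card_insert_if)
    finally show "dim ((*v) M ` span {u k, v k}) \<le> 2" .
    have "(\<lambda>c. \<Sum>i=1..l. R c i) ` {..<2} = (*v) M ` {p, q}"
      unfolding sumR by (auto simp: lessThan_nat_numeral lessThan_Suc)
    then show "(*v) M ` span {p, q} = span ((\<lambda>c. \<Sum>i=1..l. R c i) ` {..<2})"
      by (simp only: linear_span_image[OF linM])
    show "subspace ((*v) M ` sum_space (krylov m (K ** K) p) (krylov m (K ** K) q))"
      unfolding sum_space_def krylov_def
      by (intro linear_subspace_image linM subspace_sums subspace_span)
    show "(\<Sum>i=1..l. poly f (- (\<sigma> i)\<^sup>2) *\<^sub>R R c i)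
        \<in> (*v) M ` sum_space (krylov m (K ** K) p) (krylov m (K ** K) q)" for c
    proof -
      have 0: "0 \<in> krylov m (K ** K) x" for x by (simp add: krylov_def span_zero)
      have "(\<Sum>i=1..l. poly f (- (\<sigma> i)\<^sup>2) *\<^sub>R \<pi> i (if c = 0 then p else q))
          \<in> sum_space (krylov m (K ** K) p) (krylov m (K ** K) q)"
        using sum_spaceI1[OF 0 pK[OF pr]] sum_spaceI2[OF 0 pK[OF q]] by simp
      then show ?thesis
        unfolding R_def
        by (simp add: linear_sum[OF linM, symmetric] matrix_vector_mult_scaleR[symmetric] image_eqI)
    qed
  qed (use k f C in auto)
  then show ?thesis by (simp add: tan_angles_frobenius_eq M_def)
qed

section \<open>The convergence bounds\<close>

theorem theorem3p2:
  fixes A B :: "real^'n^'n"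
    and \<sigma> :: "nat \<Rightarrow> real"
    and u v :: "nat \<Rightarrow> real^'n"
    and p1 q1 :: "real^'n"
    and F :: "real^2^'n"
    and X :: "nat \<Rightarrow> real^2^'n"
    and FF UU VV :: "(real^'n) set"
    and XX :: "nat \<Rightarrow> (real^'n) set"
    and l m j :: nat
  assumes skew: "skew_symmetric A"
    and spd: "sym_pos_def B"
    and rank: "2 * l = rank A"
    and eigenvalues: "{z. z \<noteq> 0 \<and> pencil_eigenvalue A B z} =
          (\<Union>i\<in>{1..l}. {\<i> * of_real (\<sigma> i), - \<i> * of_real (\<sigma> i)})"
    and simple: "\<And>z. z \<noteq> 0 \<Longrightarrow> pencil_eigenvalue A B z \<Longrightarrow> simple_pencil_eigenvalue A B z"
    and sigma_pos: "\<And>i. i \<in> {1..l} \<Longrightarrow> \<sigma> i > 0"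
    and sigma_decreasing: "\<And>i k. i \<in> {1..l} \<Longrightarrow> k \<in> {1..l} \<Longrightarrow> i < k \<Longrightarrow> \<sigma> i > \<sigma> k"
    and A_v: "\<And>i. i \<in> {1..l} \<Longrightarrow> A *v v i = \<sigma> i *\<^sub>R (B *v u i)"
    and A_u: "\<And>i. i \<in> {1..l} \<Longrightarrow> A *v u i = - \<sigma> i *\<^sub>R (B *v v i)"
    and orthonormal_uu: "\<And>i k. i \<in> {1..l} \<Longrightarrow> k \<in> {1..l} \<Longrightarrow>
          inner_B B (u i) (u k) = (if i = k then 1 else 0)"
    and orthonormal_vv: "\<And>i k. i \<in> {1..l} \<Longrightarrow> k \<in> {1..l} \<Longrightarrow>
          inner_B B (v i) (v k) = (if i = k then 1 else 0)"
    and orthogonal_uv: "\<And>i k. i \<in> {1..l} \<Longrightarrow> k \<in> {1..l} \<Longrightarrow> inner_B B (u i) (v k) = 0"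
    and m_less: "m < l"
    and q1_norm: "norm_B B q1 = 1"
    and q1_range: "q1 \<in> range ((*v) (matrix_inv B ** A))"
    and no_breakdown: "\<not> gsslbd_breaks_down A B q1 m"
    and p1: "p1 = (matrix_inv B ** A) *v q1 /\<^sub>R norm_B B ((matrix_inv B ** A) *v q1)"
    and F: "F = two_cols p1 q1"
    and FF: "FF = span {p1, q1}"
    and UU: "UU = krylov m ((matrix_inv B ** A) ** (matrix_inv B ** A)) p1"
    and VV: "VV = krylov m ((matrix_inv B ** A) ** (matrix_inv B ** A)) q1"
    and j: "1 \<le> j" "j \<le> m"
    and X: "\<And>i. i \<in> {1..l} \<Longrightarrow> X i = two_cols (u i) (v i)"
    and XX: "\<And>i. i \<in> {1..l} \<Longrightarrow> XX i = span {u i, v i}"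
  shows "(invertible (transpose (X j) ** B ** F) \<longrightarrow>
            tan_angles_frobenius B (sum_space UU VV) (XX j)
              \<le> ereal (eta \<sigma> l j / chebyshev (m - j) (xi \<sigma> l j))
                 * tan_angles_frobenius B FF (XX j))
       \<and> (invertible (transpose (X (l - j + 1)) ** B ** F) \<longrightarrow>
            tan_angles_frobenius B (sum_space UU VV) (XX (l - j + 1))
              \<le> ereal (eta' \<sigma> l j / chebyshev (m - j) (xi' \<sigma> l j))
                 * tan_angles_frobenius B FF (XX (l - j + 1)))"
proof -
  have sq: "(\<sigma> k)\<^sup>2 < (\<sigma> i)\<^sup>2" if "i \<in> {1..l}" "k \<in> {1..l}" "i < k" for i k
    using sigma_decreasing[OF that] sigma_pos[OF that(2)] by (intro power_strict_mono) auto
  have bound: "tan_angles_frobenius B (sum_space UU VV) (XX k)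
      \<le> ereal C * tan_angles_frobenius B FF (XX k)"
    if k: "k \<in> {1..l}" and inv: "invertible (transpose (X k) ** B ** F)"
      and f: "degree f < m" "poly f (- (\<sigma> k)\<^sup>2) = 1" and C: "0 \<le> C"
        "\<And>i. i \<in> {1..l} \<Longrightarrow> i \<noteq> k \<Longrightarrow> \<bar>poly f (- (\<sigma> i)\<^sup>2)\<bar> \<le> C" for k f C
    unfolding UU VV FF XX[OF k]
  proof (rule pencil_angle_bound[OF skew spd rank _ A_v A_u orthonormal_uu orthonormal_vv orthogonal_uv
        q1_range p1 k _ f C])
    show "\<sigma> i \<noteq> 0" if "i \<in> {1..l}" for i using sigma_pos[OF that] by simp
    show "invertible (transpose (two_cols (u k) (v k)) ** B ** two_cols p1 q1)"
      using inv by (simp add: X[OF k] F)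
  qed
  show ?thesis
  proof (intro conjI impI)
    assume inv: "invertible (transpose (X j) ** B ** F)"
    have eta: "(\<Prod>i=1..j-1. ((\<sigma> i)\<^sup>2 - (\<sigma> l)\<^sup>2) / ((\<sigma> i)\<^sup>2 - (\<sigma> j)\<^sup>2)) = eta \<sigma> l j"
      by (simp add: eta_def)
    obtain f where f: "degree f < m" "poly f ((\<sigma> j)\<^sup>2) = 1"
      "0 \<le> eta \<sigma> l j / chebyshev (m - j) (xi \<sigma> l j)"
      "\<And>i. i \<in> {1..l} \<Longrightarrow> i \<noteq> j \<Longrightarrow>
        \<bar>poly f ((\<sigma> i)\<^sup>2)\<bar> \<le> eta \<sigma> l j / chebyshev (m - j) (xi \<sigma> l j)"
      using filter_polynomial[where c = "\<lambda>i. (\<sigma> i)\<^sup>2", OF sq j m_less]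
      unfolding eta xi_def[symmetric] by blast
    \<comment> \<open>the eigenvalues of \<open>K\<^sup>2\<close> are \<open>- (\<sigma> i)\<^sup>2\<close>, hence the reflected argument\<close>
    have deg: "degree (pcompose f [:0, -1:]) < m"
      using degree_pcompose_le[of f "[:0, -1:]"] f(1) by simp
    show "tan_angles_frobenius B (sum_space UU VV) (XX j)
        \<le> ereal (eta \<sigma> l j / chebyshev (m - j) (xi \<sigma> l j)) * tan_angles_frobenius B FF (XX j)"
      using j m_less f by (intro bound[OF _ inv deg]) (simp_all add: poly_pcompose)
  next
    define j' where "j' = l - j + 1"
    assume inv: "invertible (transpose (X (l - j + 1)) ** B ** F)"
    have j': "j' \<in> {1..l}" "l - j' + 1 = j" using j m_less by (auto simp: j'_def)
    define C where "C = eta' \<sigma> l j / chebyshev (m - j) (xi' \<sigma> l j)"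
    \<comment> \<open>Counting the eigenvalues \<open>- (\<sigma> i)\<^sup>2\<close> from the other end makes them decreasing again, and turns
      \<open>eta\<close>, \<open>xi\<close> into \<open>eta'\<close>, \<open>xi'\<close>: numerators and denominators just change sign.\<close>
    let ?c = "\<lambda>i. - (\<sigma> (l - i + 1))\<^sup>2"
    have dec: "?c k < ?c i" if "i \<in> {1..l}" "k \<in> {1..l}" "i < k" for i k
    proof -
      have "(\<sigma> (l - i + 1))\<^sup>2 < (\<sigma> (l - k + 1))\<^sup>2" using that by (intro sq) auto
      then show ?thesis by simp
    qed
    have flip: "(- a - - b) / (- c - - d) = (a - b) / (c - d)" for a b c d :: real
      by (metis minus_diff_minus minus_divide_divide)
    have eta: "(\<Prod>i=1..j-1. (?c i - ?c l) / (?c i - ?c j)) = eta' \<sigma> l j"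
    proof (cases "j = 1")
      case False
      have "(?c i - ?c l) / (?c i - ?c j) = ((\<sigma> (l - i + 1))\<^sup>2 - (\<sigma> 1)\<^sup>2) / ((\<sigma> (l - i + 1))\<^sup>2 - (\<sigma> (l - j + 1))\<^sup>2)"
        for i unfolding flip by simp
      then show ?thesis using False by (simp add: eta'_def)
    qed (simp add: eta'_def)
    have "l - (j + 1) + 1 = l - j" using j m_less by simp
    then have xi: "1 + 2 * ((?c j - ?c (j + 1)) / (?c (j + 1) - ?c l)) = xi' \<sigma> l j"
      unfolding flip
      by (simp add: xi'_def)
    obtain f where f: "degree f < m" "poly f (?c j) = 1" "0 \<le> C"
      "\<And>i. i \<in> {1..l} \<Longrightarrow> i \<noteq> j \<Longrightarrow> \<bar>poly f (?c i)\<bar> \<le> C"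
      using filter_polynomial[where c = ?c, OF dec j m_less] unfolding eta xi C_def by blast
    have "\<bar>poly f (- (\<sigma> i)\<^sup>2)\<bar> \<le> C" if "i \<in> {1..l}" "i \<noteq> j'" for i
    proof -
      have "l - i + 1 \<in> {1..l}" "l - i + 1 \<noteq> j" "l - (l - i + 1) + 1 = i"
        using that j m_less by (auto simp: j'_def)
      then show ?thesis using f(4)[of "l - i + 1"] by metis
    qed
    then show "tan_angles_frobenius B (sum_space UU VV) (XX (l - j + 1))
        \<le> ereal (eta' \<sigma> l j / chebyshev (m - j) (xi' \<sigma> l j)) * tan_angles_frobenius B FF (XX (l - j + 1))"
      using bound[of j' f C] j' inv f by (simp add: j'_def C_def)
  qed
qed

end
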